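(* Let $K$ be a field, let $n\ge 4$, and let $G=K_{2,n-2}$ be the complete bipartite graph on the vertex set $V_1\cup V_2=[n]=\{1,\dots,n\}$ with parts $V_1=\{1,2\}$ and $V_2=\{3,\dots,n\}$. Let $<$ be a reverse lexicographic order on $K[q]$ satisfying $q_{A|B}<q_{C|D}$ whenever $\min\{|A|,|B|\}<\min\{|C|,|D|\}$. Then the following binomials form a Gröbner basis of the cut ideal $I_G$ with respect to $<$, where $A|B$ and $C|D$ range over the partitions of $[n]$ satisfying the indicated conditions: (i) $q_{A|B}\,q_{E|F}-q_{\emptyset|[n]}\,q_{\{1,2\}|\{3,\dots,n\}}$, for $1\in A$, $2\in B$, where $E=(B\cup\{1\})\setminus\{2\}$ and $F=(A\cup\{2\})\setminus\{1\}$; (ii) $q_{A|B}\,q_{C|D}-q_{A\cap C|B\cup D}\,q_{A\cup C|B\cap D}$, for $1\in A\cap C$, $2\in B\cap D$, $A\not\subset C$, $C\not\subset A$; (iii) $q_{A|B}\,q_{C|D}-q_{A\cap C|B\cup D}\,q_{A\cup C|B\cap D}$, for $1,2\in A\cap C$, $A\not\subset C$, $C\not\subset A$. Moreover, the initial monomial with respect to $<$ of each of these binomials is the first monomial written.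
   Context: Let $G$ be a finite simple graph with vertex set $V(G)$ and edge set $E(G)$. For each unordered partition $A|B$ of $V(G)$ (that is, $A\cap B=\emptyset$, $A\cup B=V(G)$, possibly with $A$ or $B$ empty, and $A|B=B|A$, so $q_{A|B}=q_{B|A}$) take a variable $q_{A|B}$, and let $K[q]$ be the polynomial ring over $K$ in these $2^{|V(G)|-1}$ variables. Let $K[s,T]=K[s,t_{ij}\mid ij\in E(G)]$. Define the $K$-algebra homomorphism $\pi_G:K[q]\to K[s,T]$ by $\pi_G(q_{A|B})=s\cdot\prod_{ij\in E(G),\ |A\cap\{i,j\}|=1}t_{ij}$. The cut ideal $I_G$ is $\ker\pi_G$. Reverse lexicographic order means the graded reverse lexicographic order induced by a total order of the variables: for monomials of the same degree, $u<v$ if, for the smallest variable whose exponents in $u$ and $v$ differ, its exponent in $u$ is larger than in $v$. *)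

theory Defs
  imports "HOL-Library.Poly_Mapping" "HOL-Algebra.RingHom"
begin

section \<open>Polynomials in a prescribed set of variables\<close>

type_synonym 'x mono = "'x \<Rightarrow>\<^sub>0 nat"
type_synonym ('x, 'k) mpoly = "('x \<Rightarrow>\<^sub>0 nat) \<Rightarrow>\<^sub>0 'k"

definition mvar :: "'x \<Rightarrow> 'x mono" where
  "mvar x = Poly_Mapping.single x 1"

definition monomial_poly :: "'x mono \<Rightarrow> ('x, 'k::field) mpoly" where
  "monomial_poly m = Poly_Mapping.single m 1"

definition monomials :: "'x set \<Rightarrow> 'x mono set" where
  "monomials X = {m. Poly_Mapping.keys m \<subseteq> X}"

text \<open>The polynomial ring \<open>K[X]\<close>. The variable type \<open>'x\<close> may be larger than \<open>X\<close>; the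
  carrier restricts to the polynomials involving only variables from \<open>X\<close>.\<close>

definition poly_ring :: "'x set \<Rightarrow> ('x, 'k::field) mpoly ring" where
  "poly_ring X = \<lparr>carrier = {p. Poly_Mapping.keys p \<subseteq> monomials X},
     monoid.mult = (*), one = 1, zero = 0, add = (+)\<rparr>"

lemma cring_poly_ring: "cring (poly_ring X)"
proof -
  have add: "p + r \<in> carrier (poly_ring X)" and mult: "p * r \<in> carrier (poly_ring X)"
    and inv: "- p \<in> carrier (poly_ring X)"
    if "p \<in> carrier (poly_ring X)" "r \<in> carrier (poly_ring X)" for p r :: "('a, 'b) mpoly"
  proof -
    have p: "Poly_Mapping.keys p \<subseteq> monomials X" and r: "Poly_Mapping.keys r \<subseteq> monomials X"
      using that by (auto simp: poly_ring_def)
    show "p + r \<in> carrier (poly_ring X)"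
      using p r Poly_Mapping.keys_add[of p r] by (auto simp: poly_ring_def)
    have "u + v \<in> monomials X" if "u \<in> monomials X" "v \<in> monomials X" for u v
      using that Poly_Mapping.keys_add[of u v] by (auto simp: monomials_def)
    then show "p * r \<in> carrier (poly_ring X)"
      using p r keys_mult[of p r] by (fastforce simp: poly_ring_def)
    show "- p \<in> carrier (poly_ring X)"
      using p by (auto simp: poly_ring_def in_keys_iff)
  qed
  have "abelian_group (poly_ring X :: ('a, 'b) mpoly ring)"
  proof (rule abelian_groupI)
    fix p :: "('a, 'b) mpoly"
    assume p: "p \<in> carrier (poly_ring X)"
    then have "- p \<in> carrier (poly_ring X)" by (rule inv[OF _ p])
    then show "\<exists>y\<in>carrier (poly_ring X). y \<oplus>\<^bsub>poly_ring X\<^esub> p = \<zero>\<^bsub>poly_ring X\<^esub>"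
      by (intro bexI[of _ "- p"]) (auto simp: poly_ring_def)
  qed (use add in \<open>auto simp: poly_ring_def algebra_simps\<close>)
  moreover have "comm_monoid (poly_ring X :: ('a, 'b) mpoly ring)"
    by (rule comm_monoidI) (use mult in \<open>auto simp: poly_ring_def monomials_def algebra_simps\<close>)
  ultimately show ?thesis
    by (rule cringI) (auto simp: poly_ring_def algebra_simps)
qed

text \<open>The \<open>K\<close>-algebra homomorphism sending each variable \<open>x\<close> to \<open>f x\<close>.\<close>

definition poly_subst :: "('x \<Rightarrow> ('y, 'k::field) mpoly) \<Rightarrow> ('x, 'k) mpoly \<Rightarrow> ('y, 'k) mpoly" where
  "poly_subst f p = (\<Sum>m\<in>Poly_Mapping.keys p.
     Poly_Mapping.single 0 (Poly_Mapping.lookup p m) *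
       (\<Prod>x\<in>Poly_Mapping.keys m. f x ^ Poly_Mapping.lookup m x))"


section \<open>Reverse lexicographic orders and Groebner bases\<close>

definition mono_degree :: "'x mono \<Rightarrow> nat" where
  "mono_degree m = (\<Sum>x\<in>Poly_Mapping.keys m. Poly_Mapping.lookup m x)"

definition grevlex :: "'x rel \<Rightarrow> 'x mono \<Rightarrow> 'x mono \<Rightarrow> bool" where
  "grevlex r u v \<longleftrightarrow> mono_degree u < mono_degree v \<or>
     mono_degree u = mono_degree v \<and>
       (\<exists>x. Poly_Mapping.lookup u x > Poly_Mapping.lookup v x \<and>
            (\<forall>y. (y, x) \<in> r \<and> y \<noteq> x \<longrightarrow> Poly_Mapping.lookup u y = Poly_Mapping.lookup v y))"

text \<open>Here \<open>lt\<close> is the strict order; its values outside the monomials of \<open>K[X]\<close> are irrelevant.\<close>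

definition revlex_order_on :: "'x set \<Rightarrow> ('x mono \<Rightarrow> 'x mono \<Rightarrow> bool) \<Rightarrow> bool" where
  "revlex_order_on X lt \<longleftrightarrow>
     (\<exists>r. linear_order_on X r \<and> (\<forall>u\<in>monomials X. \<forall>v\<in>monomials X. lt u v \<longleftrightarrow> grevlex r u v))"

text \<open>The initial monomial, meaningful for nonzero polynomials only.\<close>

definition initial_mono :: "('x mono \<Rightarrow> 'x mono \<Rightarrow> bool) \<Rightarrow> ('x, 'k::field) mpoly \<Rightarrow> 'x mono" where
  "initial_mono lt p =
     (THE m. m \<in> Poly_Mapping.keys p \<and> (\<forall>u\<in>Poly_Mapping.keys p. u \<noteq> m \<longrightarrow> lt u m))"

definition initial :: "('x mono \<Rightarrow> 'x mono \<Rightarrow> bool) \<Rightarrow> ('x, 'k::field) mpoly \<Rightarrow> ('x, 'k) mpoly" where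
  "initial lt p = monomial_poly (initial_mono lt p)"

definition initial_ideal ::
    "'x set \<Rightarrow> ('x mono \<Rightarrow> 'x mono \<Rightarrow> bool) \<Rightarrow> ('x, 'k::field) mpoly set \<Rightarrow> ('x, 'k) mpoly set" where
  "initial_ideal X lt I = Idl\<^bsub>poly_ring X\<^esub> (initial lt ` (I - {0}))"

definition groebner_basis ::
    "'x set \<Rightarrow> ('x mono \<Rightarrow> 'x mono \<Rightarrow> bool) \<Rightarrow> ('x, 'k::field) mpoly set \<Rightarrow> ('x, 'k) mpoly set \<Rightarrow> bool" where
  "groebner_basis X lt I S \<longleftrightarrow> finite S \<and> S \<subseteq> I \<and>
     Idl\<^bsub>poly_ring X\<^esub> (initial lt ` (S - {0})) = initial_ideal X lt I"


section \<open>Cut ideals\<close>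

text \<open>An unordered partition \<open>A|B\<close> is encoded as the set \<open>{A, B}\<close>, an edge \<open>ij\<close> as \<open>{i, j}\<close>.\<close>

definition bipartition :: "'v set \<Rightarrow> 'v set \<Rightarrow> 'v set \<Rightarrow> bool" where
  "bipartition V A B \<longleftrightarrow> A \<inter> B = {} \<and> A \<union> B = V"

definition cuts :: "'v set \<Rightarrow> 'v set set set" where
  "cuts V = {{A, B} | A B. bipartition V A B}"

definition q :: "'v set \<Rightarrow> 'v set \<Rightarrow> ('v set set, 'k::field) mpoly" where
  "q A B = monomial_poly (mvar {A, B})"

datatype 'v st_var = S | T "'v set"

text \<open>The edges cut by \<open>A|B\<close>. As \<open>|A \<inter> e| = 1\<close> iff \<open>|B \<inter> e| = 1\<close> for every edge \<open>e\<close>, it does not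
  matter which side of the partition is tested.\<close>

definition cut_edges :: "'v set set \<Rightarrow> 'v set set \<Rightarrow> 'v set set" where
  "cut_edges E c = {e \<in> E. \<exists>A\<in>c. card (A \<inter> e) = 1}"

definition cut_hom ::
    "'v set set \<Rightarrow> ('v set set, 'k::field) mpoly \<Rightarrow> ('v st_var, 'k) mpoly" where
  "cut_hom E = poly_subst (\<lambda>c. monomial_poly (mvar S) *
     (\<Prod>e\<in>cut_edges E c. monomial_poly (mvar (T e))))"

definition cut_ideal :: "'v set \<Rightarrow> 'v set set \<Rightarrow> ('v set set, 'k::field) mpoly set" where
  "cut_ideal V E = a_kernel (poly_ring (cuts V)) (poly_ring (insert S (T ` E))) (cut_hom E)"

definition complete_bipartite_edges :: "'v set \<Rightarrow> 'v set \<Rightarrow> 'v set set" where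
  "complete_bipartite_edges V1 V2 = {{i, j} | i j. i \<in> V1 \<and> j \<in> V2}"

lemma cut_edges_bipartition:
  assumes "finite V" "\<forall>e\<in>E. e \<subseteq> V \<and> card e = 2" "bipartition V A B"
  shows "cut_edges E {A, B} = {e \<in> E. card (A \<inter> e) = 1}"
proof -
  have "card (A \<inter> e) = 1 \<longleftrightarrow> card (B \<inter> e) = 1" if "e \<in> E" for e
  proof -
    have e: "e \<subseteq> V" "card e = 2" using assms(2) that by auto
    then have "finite e" by (metis card.infinite zero_neq_numeral)
    moreover have "e = (A \<inter> e) \<union> (B \<inter> e)" "(A \<inter> e) \<inter> (B \<inter> e) = {}"
      using assms(3) e unfolding bipartition_def by auto
    ultimately have "card (A \<inter> e) + card (B \<inter> e) = 2"
      using e(2) by (metis card_Un_disjoint finite_Un)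
    then show ?thesis by linarith
  qed
  then show ?thesis unfolding cut_edges_def by auto
qed

lemma cut_hom_q:
  "cut_hom E (q A B) = monomial_poly (mvar S) *
     (\<Prod>e\<in>cut_edges E {A, B}. monomial_poly (mvar (T e)))"
  by (simp add: cut_hom_def poly_subst_def q_def monomial_poly_def mvar_def)

end

theory Submission
  imports Defs
begin

text \<open>The cut ideal is the kernel of a monomial map, so it suffices that distinct standard monomials,
  those divisible by none of the proposed initial monomials, have distinct images. Encode a cut
  by the trace on \<open>W = {3..n}\<close> of the side containing 1. In a standard monomial the cuts separating 1
  from 2 form a chain of subsets of \<open>W\<close> that does not contain both \<open>{}\<close> and \<open>W\<close>, and the remaining cuts
  form another chain. A chain with multiplicities is determined by its length and by the number of
  members containing each \<open>j \<in> W\<close>; the image monomial yields these numbers once the length of the first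
  chain is known, and the excluded pair \<open>{}\<close>, \<open>W\<close> is what makes this length unique.\<close>

section \<open>Reverse lexicographic orders\<close>

text \<open>A separating cut with trace X cuts the edge 1j iff j is outside X and the edge 2j iff j
  is in X; a cut with 1 and 2 on one side cuts both edges or neither. So the image gives only the
  total number of cuts and, for each j, two sums that mix both chains. What it cannot see is the
  trade behind (i): the separating traces \<open>{}\<close> and \<open>W\<close> together have the
  same image as the joining traces \<open>{}\<close> and \<open>W\<close>, since either pair cuts
  every edge exactly once. This is the obstacle to reading off the length of the first chain; the
  member of (i) with \<open>A = {1}\<close> forbids one of the two pairs, while (ii) and (iii) turn
  each family into a chain. The hypothesis on the order serves to identify initial monomials: the
  second monomial of each binomial contains a cut whose smaller side is smaller than every side
  occurring in the first, and a reverse lexicographic order makes a monomial small as soon as it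
  contains such a small variable, whatever its other factor is.\<close>

lemma finite_linear_order_minimal:
  assumes "linear_order_on X r" "finite D" "D \<noteq> {}" "D \<subseteq> X"
  shows "\<exists>x\<in>D. \<forall>y\<in>D. (x, y) \<in> r"
  using assms(2-4)
proof (induction D rule: finite_ne_induct)
  case (singleton x)
  then show ?case using assms(1) by (auto simp: order_on_defs refl_on_def)
next
  case (insert x D)
  then obtain z where z: "z \<in> D" "\<forall>y\<in>D. (z, y) \<in> r" by auto
  have lin: "trans r" "refl_on X r" "total_on X r"
    using assms(1) by (auto simp: order_on_defs)
  show ?case
  proof (cases "(z, x) \<in> r")
    case True
    with z show ?thesis by blast
  next
    case False
    then have "(x, z) \<in> r" using lin(2,3) insert.prems z(1)
      unfolding total_on_def refl_on_def by (metis insert_subset subsetD)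
    moreover have "(x, x) \<in> r" using lin(2) insert.prems by (auto simp: refl_on_def)
    ultimately show ?thesis using z(2) lin(1) by (metis insert_iff transD)
  qed
qed

lemma mono_degree_eq_sum:
  assumes "finite F" "Poly_Mapping.keys m \<subseteq> F"
  shows "mono_degree m = sum (Poly_Mapping.lookup m) F"
  unfolding mono_degree_def
  by (rule sum.mono_neutral_left) (use assms in \<open>auto simp: in_keys_iff\<close>)

lemma mono_degree_add: "mono_degree (u + v) = mono_degree u + mono_degree v"
proof -
  let ?F = "Poly_Mapping.keys u \<union> Poly_Mapping.keys v"
  show ?thesis
    using Poly_Mapping.keys_add[of u v]
    by (simp add: mono_degree_eq_sum[of ?F] lookup_add sum.distrib)
qed

lemma mono_degree_mvar [simp]: "mono_degree (mvar x) = 1"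
  by (simp add: mono_degree_def mvar_def)

lemma monomials_add: "u \<in> monomials X \<Longrightarrow> v \<in> monomials X \<Longrightarrow> u + v \<in> monomials X"
  using Poly_Mapping.keys_add[of u v] by (auto simp: monomials_def)

lemma monomials_mvar: "x \<in> X \<Longrightarrow> mvar x \<in> monomials X"
  by (auto simp: monomials_def mvar_def)

lemma monomials_lookup_pos: "u \<in> monomials X \<Longrightarrow> Poly_Mapping.lookup u x > k \<Longrightarrow> x \<in> X"
  by (auto simp: monomials_def in_keys_iff subset_iff)

lemma grevlex_degree_le: "grevlex r u v \<Longrightarrow> mono_degree u \<le> mono_degree v"
  unfolding grevlex_def by linarith

lemma grevlexE:
  assumes "grevlex r u v" "mono_degree u = mono_degree v"
  obtains x where "Poly_Mapping.lookup u x > Poly_Mapping.lookup v x"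
    "\<forall>z. (z, x) \<in> r \<and> z \<noteq> x \<longrightarrow> Poly_Mapping.lookup u z = Poly_Mapping.lookup v z"
  using assms unfolding grevlex_def by (metis less_irrefl)

text \<open>Opposite comparisons in equal degree would be decided at two distinct variables. Both
  occur with positive exponent, so they lie in \<open>X\<close> and are comparable; the smaller
  contradicts the agreement required below the larger.\<close>

lemma grevlex_asym:
  assumes "linear_order_on X r" "u \<in> monomials X" "v \<in> monomials X" "grevlex r u v"
  shows "\<not> grevlex r v u"
proof
  assume vu: "grevlex r v u"
  then have deg: "mono_degree u = mono_degree v"
    using grevlex_degree_le assms(4) by (metis order_antisym)
  obtain x y where
    x: "Poly_Mapping.lookup u x > Poly_Mapping.lookup v x"
      "\<forall>z. (z, x) \<in> r \<and> z \<noteq> x \<longrightarrow> Poly_Mapping.lookup u z = Poly_Mapping.lookup v z" and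
    y: "Poly_Mapping.lookup v y > Poly_Mapping.lookup u y"
      "\<forall>z. (z, y) \<in> r \<and> z \<noteq> y \<longrightarrow> Poly_Mapping.lookup v z = Poly_Mapping.lookup u z"
    using grevlexE[OF assms(4) deg] grevlexE[OF vu deg[symmetric]] by metis
  then have "x \<noteq> y" "x \<in> X" "y \<in> X"
    using assms(2,3) by (auto intro: monomials_lookup_pos)
  then have "(x, y) \<in> r \<or> (y, x) \<in> r"
    using assms(1) by (auto simp: order_on_defs total_on_def)
  then show False using x y \<open>x \<noteq> y\<close> by (metis less_irrefl)
qed

text \<open>In equal degree, the smaller of the two deciding variables decides the composite
  comparison, because below it all three monomials agree.\<close>

lemma grevlex_trans:
  assumes "linear_order_on X r" "u \<in> monomials X" "v \<in> monomials X" "w \<in> monomials X"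
    and "grevlex r u v" "grevlex r v w"
  shows "grevlex r u w"
proof (cases "mono_degree u = mono_degree v \<and> mono_degree v = mono_degree w")
  case False
  then show ?thesis using assms(5,6) by (auto simp: grevlex_def)
next
  case True
  then have deg: "mono_degree u = mono_degree v" "mono_degree v = mono_degree w" by auto
  obtain x y where
    x: "Poly_Mapping.lookup u x > Poly_Mapping.lookup v x"
      "\<forall>z. (z, x) \<in> r \<and> z \<noteq> x \<longrightarrow> Poly_Mapping.lookup u z = Poly_Mapping.lookup v z" and
    y: "Poly_Mapping.lookup v y > Poly_Mapping.lookup w y"
      "\<forall>z. (z, y) \<in> r \<and> z \<noteq> y \<longrightarrow> Poly_Mapping.lookup v z = Poly_Mapping.lookup w z"
    using grevlexE[OF assms(5) deg(1)] grevlexE[OF assms(6) deg(2)] by metis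
  have "trans r" "antisym r" and tot: "total_on X r"
    using assms(1) by (auto simp: order_on_defs)
  have "x \<in> X" "y \<in> X"
    using x(1) y(1) assms(2,3) by (auto intro: monomials_lookup_pos)
  then consider "x = y" | "x \<noteq> y" "(x, y) \<in> r" | "x \<noteq> y" "(y, x) \<in> r"
    using tot unfolding total_on_def by blast
  then show ?thesis
  proof cases
    case 1
    with x y True show ?thesis unfolding grevlex_def by (metis order.strict_trans)
  next
    case 2
    have "(z, y) \<in> r \<and> z \<noteq> y" if "(z, x) \<in> r \<and> z \<noteq> x" for z
      using that 2 \<open>trans r\<close> \<open>antisym r\<close> by (metis antisymD transD)
    then have "\<forall>z. (z, x) \<in> r \<and> z \<noteq> x \<longrightarrow> Poly_Mapping.lookup u z = Poly_Mapping.lookup w z"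
      using x(2) y(2) by metis
    moreover have "Poly_Mapping.lookup u x > Poly_Mapping.lookup w x"
      using x(1) y(2) 2 by metis
    ultimately show ?thesis using True unfolding grevlex_def by metis
  next
    case 3
    have "(z, x) \<in> r \<and> z \<noteq> x" if "(z, y) \<in> r \<and> z \<noteq> y" for z
      using that 3 \<open>trans r\<close> \<open>antisym r\<close> by (metis antisymD transD)
    then have "\<forall>z. (z, y) \<in> r \<and> z \<noteq> y \<longrightarrow> Poly_Mapping.lookup u z = Poly_Mapping.lookup w z"
      using x(2) y(2) by metis
    moreover have "Poly_Mapping.lookup u y > Poly_Mapping.lookup w y"
      using y(1) x(2) 3 by metis
    ultimately show ?thesis using True unfolding grevlex_def by metis
  qed
qed

lemma grevlex_total:
  assumes "linear_order_on X r" "u \<in> monomials X" "v \<in> monomials X" "u \<noteq> v"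
  shows "grevlex r u v \<or> grevlex r v u"
proof (cases "mono_degree u = mono_degree v")
  case False
  then show ?thesis by (auto simp: grevlex_def)
next
  case True
  \<comment> \<open>The \<open>r\<close>-least variable in \<open>D\<close> decides the comparison;
    it exists because supports are finite.\<close>
  define D where "D = {x. Poly_Mapping.lookup u x \<noteq> Poly_Mapping.lookup v x}"
  have sub: "D \<subseteq> Poly_Mapping.keys u \<union> Poly_Mapping.keys v"
    by (auto simp: D_def in_keys_iff)
  have "D \<noteq> {}" using assms(4) by (auto simp: D_def intro: poly_mapping_eqI)
  moreover have "finite D" using sub by (rule finite_subset) simp
  moreover have "D \<subseteq> X" using sub assms(2,3) by (auto simp: monomials_def)
  ultimately obtain x where x: "x \<in> D" "\<forall>y\<in>D. (x, y) \<in> r"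
    using finite_linear_order_minimal[OF assms(1)] by blast
  have "antisym r" using assms(1) by (auto simp: order_on_defs)
  then have "\<forall>z. (z, x) \<in> r \<and> z \<noteq> x \<longrightarrow> Poly_Mapping.lookup u z = Poly_Mapping.lookup v z"
    using x by (auto simp: D_def dest: antisymD)
  moreover have "Poly_Mapping.lookup u x < Poly_Mapping.lookup v x \<or> Poly_Mapping.lookup v x < Poly_Mapping.lookup u x"
    using x(1) by (auto simp: D_def)
  ultimately show ?thesis using True unfolding grevlex_def by metis
qed

lemma grevlex_add:
  assumes "grevlex r u v"
  shows "grevlex r (w + u) (w + v)"
  using assms by (auto simp: grevlex_def mono_degree_add lookup_add)

lemma revlex_asym:
  assumes "revlex_order_on X lt" "u \<in> monomials X" "v \<in> monomials X" "lt u v"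
  shows "\<not> lt v u"
  using assms grevlex_asym unfolding revlex_order_on_def by metis

lemma revlex_trans:
  assumes "revlex_order_on X lt" "u \<in> monomials X" "v \<in> monomials X" "w \<in> monomials X"
    and "lt u v" "lt v w"
  shows "lt u w"
  using assms grevlex_trans unfolding revlex_order_on_def by metis

lemma revlex_total:
  assumes "revlex_order_on X lt" "u \<in> monomials X" "v \<in> monomials X" "u \<noteq> v"
  shows "lt u v \<or> lt v u"
  using assms grevlex_total unfolding revlex_order_on_def by metis

lemma revlex_add:
  assumes "revlex_order_on X lt" "u \<in> monomials X" "v \<in> monomials X" "w \<in> monomials X"
    and "lt u v"
  shows "lt (w + u) (w + v)"
  using assms grevlex_add monomials_add unfolding revlex_order_on_def by metis

lemma revlex_minimal:
  assumes "revlex_order_on X lt" "finite M" "M \<noteq> {}" "M \<subseteq> monomials X"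
  shows "\<exists>m\<in>M. \<forall>u\<in>M. \<not> lt u m"
  using assms(2-4)
proof (induction M rule: finite_ne_induct)
  case (singleton x)
  then show ?case using revlex_asym[OF assms(1)] by auto
next
  case (insert x F)
  then obtain m where m: "m \<in> F" "\<forall>u\<in>F. \<not> lt u m" by auto
  have "x \<in> monomials X" "F \<subseteq> monomials X" using insert.prems by auto
  with m show ?case
    using revlex_asym[OF assms(1)] revlex_trans[OF assms(1)] by (metis insert_iff subsetD)
qed

lemma revlex_maximum:
  assumes "revlex_order_on X lt" "finite M" "M \<noteq> {}" "M \<subseteq> monomials X"
  shows "\<exists>m\<in>M. \<forall>u\<in>M. u \<noteq> m \<longrightarrow> lt u m"
  using assms(2-4)
proof (induction M rule: finite_ne_induct)
  case (singleton x)
  then show ?case by auto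
next
  case (insert x F)
  then obtain m where m: "m \<in> F" "\<forall>u\<in>F. u \<noteq> m \<longrightarrow> lt u m" by auto
  have *: "x \<in> monomials X" "F \<subseteq> monomials X" "m \<noteq> x" using insert.prems insert.hyps m by auto
  show ?case
  proof (cases "lt x m")
    case True
    with m show ?thesis by auto
  next
    case False
    then have "lt m x" using revlex_total[OF assms(1)] * m(1) by blast
    with m * show ?thesis using revlex_trans[OF assms(1)] by (metis insert_iff subsetD)
  qed
qed

section \<open>Initial monomials of polynomials, in particular of binomials\<close>

lemma initial_mono_eqI:
  assumes "revlex_order_on X lt" "Poly_Mapping.keys p \<subseteq> monomials X"
    and "m \<in> Poly_Mapping.keys p" "\<And>u. u \<in> Poly_Mapping.keys p \<Longrightarrow> u \<noteq> m \<Longrightarrow> lt u m"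
  shows "initial_mono lt p = m"
  unfolding initial_mono_def
proof (rule the_equality)
  show "m \<in> Poly_Mapping.keys p \<and> (\<forall>u\<in>Poly_Mapping.keys p. u \<noteq> m \<longrightarrow> lt u m)"
    using assms(3,4) by blast
  show "m' = m" if m': "m' \<in> Poly_Mapping.keys p \<and> (\<forall>u\<in>Poly_Mapping.keys p. u \<noteq> m' \<longrightarrow> lt u m')" for m'
  proof (rule ccontr)
    assume "m' \<noteq> m"
    then have "lt m m'" "lt m' m" using m' assms(3,4) by auto
    moreover have "m \<in> monomials X" "m' \<in> monomials X" using m' assms(2,3) by auto
    ultimately show False using revlex_asym[OF assms(1)] by blast
  qed
qed

lemma initial_mono_greatest:
  assumes "revlex_order_on X lt" "Poly_Mapping.keys p \<subseteq> monomials X" "p \<noteq> 0"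
  shows "initial_mono lt p \<in> Poly_Mapping.keys p"
    and "\<And>u. u \<in> Poly_Mapping.keys p \<Longrightarrow> u \<noteq> initial_mono lt p \<Longrightarrow> lt u (initial_mono lt p)"
proof -
  obtain m where m: "m \<in> Poly_Mapping.keys p" "\<forall>u\<in>Poly_Mapping.keys p. u \<noteq> m \<longrightarrow> lt u m"
    using revlex_maximum[OF assms(1) finite_keys _ assms(2)] assms(3) by auto
  then have "initial_mono lt p = m"
    by (intro initial_mono_eqI[OF assms(1,2)]) auto
  with m show "initial_mono lt p \<in> Poly_Mapping.keys p"
    and "\<And>u. u \<in> Poly_Mapping.keys p \<Longrightarrow> u \<noteq> initial_mono lt p \<Longrightarrow> lt u (initial_mono lt p)"
    by auto
qed

lemma keys_binomial:
  assumes "a \<noteq> b"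
  shows "Poly_Mapping.keys (monomial_poly a - monomial_poly b :: ('x, 'k::field) mpoly) = {a, b}"
  using assms by (auto simp: monomial_poly_def in_keys_iff lookup_minus lookup_single when_def split: if_splits)

lemma initial_binomial:
  assumes "revlex_order_on X lt" "a \<in> monomials X" "b \<in> monomials X" "lt b a"
  shows "initial lt (monomial_poly a - monomial_poly b :: ('x, 'k::field) mpoly) = monomial_poly a"
proof -
  have "a \<noteq> b" using revlex_asym[OF assms(1)] assms(2,3,4) by blast
  then have "initial_mono lt (monomial_poly a - monomial_poly b :: ('x, 'k) mpoly) = a"
    by (intro initial_mono_eqI[OF assms(1)]) (use assms in \<open>auto simp: keys_binomial\<close>)
  then show ?thesis by (simp add: initial_def)
qed

text \<open>The smaller of \<open>e\<close> and \<open>g\<close> lies below both \<open>c\<close>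
  and \<open>d\<close>, because \<open>e\<close> does. It is thus the smallest of the four variables
  and divides only the product with \<open>e\<close> and \<open>g\<close>, which makes that product
  smaller; \<open>g\<close> may sit anywhere in the order.\<close>

lemma revlex_mvar_less:
  assumes "revlex_order_on X lt" "{c, d, e, g} \<subseteq> X" "lt (mvar e) (mvar c)" "lt (mvar e) (mvar d)"
  shows "lt (mvar e + mvar g) (mvar c + mvar d)"
proof -
  obtain r where r: "linear_order_on X r" "\<forall>u\<in>monomials X. \<forall>v\<in>monomials X. lt u v \<longleftrightarrow> grevlex r u v"
    using assms(1) by (auto simp: revlex_order_on_def)
  have lin: "trans r" "antisym r" "total_on X r" using r(1) by (auto simp: order_on_defs)
  have mX: "mvar x \<in> monomials X" if "x \<in> {c, d, e, g}" for x
    using that assms(2) by (auto intro: monomials_mvar)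
  \<comment> \<open>A comparison of single variables can only be decided at \<open>e\<close>, so
    \<open>x\<close> cannot precede \<open>e\<close> in \<open>r\<close>, and totality gives the
    converse.\<close>
  have below: "e \<noteq> x \<and> (e, x) \<in> r" if "x \<in> {c, d}" for x
  proof -
    have "grevlex r (mvar e) (mvar x)" using that assms(3,4) r(2) mX by auto
    then obtain z where z: "Poly_Mapping.lookup (mvar e) z > Poly_Mapping.lookup (mvar x) z"
        "\<forall>y. (y, z) \<in> r \<and> y \<noteq> z \<longrightarrow> Poly_Mapping.lookup (mvar e) y = Poly_Mapping.lookup (mvar x) y"
      by (rule grevlexE) simp
    from z(1) have "z = e" "e \<noteq> x" by (auto simp: mvar_def lookup_single when_def split: if_splits)
    moreover from z(2) this have "(x, e) \<notin> r" by (auto simp: mvar_def lookup_single when_def split: if_splits)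
    ultimately show ?thesis using lin(3) that assms(2) by (auto simp: total_on_def)
  qed
  obtain x where x: "x \<in> {e, g}" "\<forall>y\<in>{e, g}. (x, y) \<in> r"
    using finite_linear_order_minimal[OF r(1), of "{e, g}"] assms(2) by auto
  have xb: "x \<noteq> y \<and> (x, y) \<in> r" if "y \<in> {c, d}" for y
    using that below x(2) lin(1,2) by (metis antisymD insertI1 transD)
  have "Poly_Mapping.lookup (mvar e + mvar g) x > Poly_Mapping.lookup (mvar c + mvar d) x"
    using xb x(1) by (auto simp: mvar_def lookup_add lookup_single when_def)
  moreover have "Poly_Mapping.lookup (mvar e + mvar g) z = Poly_Mapping.lookup (mvar c + mvar d) z"
    if "(z, x) \<in> r \<and> z \<noteq> x" for z
  proof -
    have "z \<notin> {c, d, e, g}" using that xb x(2) lin(2) by (auto dest: antisymD)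
    then show ?thesis by (auto simp: mvar_def lookup_add lookup_single when_def)
  qed
  ultimately have "grevlex r (mvar e + mvar g) (mvar c + mvar d)"
    unfolding grevlex_def by (auto simp: mono_degree_add)
  then show ?thesis using r(2) mX by (simp add: monomials_add)
qed


section \<open>Groebner bases of toric ideals\<close>

text \<open>The linear map on exponent vectors behind a monomial homomorphism: the columns of its
  matrix are the \<open>f x\<close>, and \<open>Poly_Mapping.map\<close> scales a column.\<close>

definition mono_map :: "('x \<Rightarrow> 'y mono) \<Rightarrow> 'x mono \<Rightarrow> 'y mono" where
  "mono_map f m = (\<Sum>x\<in>Poly_Mapping.keys m. Poly_Mapping.map ((*) (Poly_Mapping.lookup m x)) (f x))"

text \<open>Allowing any finite superset \<open>F\<close> of the support lets several monomials
  share one index set, such as the set of all cuts.\<close>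

lemma lookup_mono_map:
  assumes "finite F" "Poly_Mapping.keys m \<subseteq> F"
  shows "Poly_Mapping.lookup (mono_map f m) y =
    (\<Sum>x\<in>F. Poly_Mapping.lookup m x * Poly_Mapping.lookup (f x) y)"
proof -
  have "Poly_Mapping.lookup (mono_map f m) y =
      (\<Sum>x\<in>Poly_Mapping.keys m. Poly_Mapping.lookup m x * Poly_Mapping.lookup (f x) y)"
    unfolding mono_map_def lookup_sum
    by (rule sum.cong) (auto simp: Poly_Mapping.map.rep_eq when_def)
  also have "\<dots> = (\<Sum>x\<in>F. Poly_Mapping.lookup m x * Poly_Mapping.lookup (f x) y)"
    by (rule sum.mono_neutral_left) (use assms in \<open>auto simp: in_keys_iff\<close>)
  finally show ?thesis .
qed

lemma mono_map_mvar: "mono_map f (mvar x) = f x"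
  by (rule poly_mapping_eqI) (simp add: lookup_mono_map[of "{x}"] mvar_def)

lemma mono_map_add: "mono_map f (u + v) = mono_map f u + mono_map f v"
proof (rule poly_mapping_eqI)
  fix y
  let ?F = "Poly_Mapping.keys u \<union> Poly_Mapping.keys v"
  show "Poly_Mapping.lookup (mono_map f (u + v)) y = Poly_Mapping.lookup (mono_map f u + mono_map f v) y"
    using Poly_Mapping.keys_add[of u v]
    by (simp add: lookup_mono_map[of ?F] lookup_add sum.distrib distrib_right)
qed

lemma monomial_poly_mult: "monomial_poly u * monomial_poly v = monomial_poly (u + v)"
  by (simp add: monomial_poly_def mult_single)

lemma monomial_poly_prod: "(\<Prod>x\<in>F. monomial_poly (g x)) = monomial_poly (\<Sum>x\<in>F. g x)"
  by (induction F rule: infinite_finite_induct)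
    (auto simp: monomial_poly_mult, auto simp: monomial_poly_def)

lemma monomial_poly_power: "monomial_poly w ^ k = monomial_poly (Poly_Mapping.map ((*) k) w)"
proof (induction k)
  case 0
  have "Poly_Mapping.map (\<lambda>_. 0 :: nat) w = 0"
    by (rule poly_mapping_eqI) (simp add: Poly_Mapping.map.rep_eq when_def)
  then show ?case by (simp add: monomial_poly_def)
next
  case (Suc k)
  have "w + Poly_Mapping.map ((*) k) w = Poly_Mapping.map ((*) (Suc k)) w"
    by (rule poly_mapping_eqI) (simp add: Poly_Mapping.map.rep_eq when_def lookup_add)
  then show ?case by (simp only: power_Suc Suc monomial_poly_mult)
qed

lemma poly_subst_monomials:
  "poly_subst (\<lambda>x. monomial_poly (f x)) p =
    (\<Sum>m\<in>Poly_Mapping.keys p. Poly_Mapping.single (mono_map f m) (Poly_Mapping.lookup p m))"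
  unfolding poly_subst_def
  by (simp add: monomial_poly_power monomial_poly_prod flip: mono_map_def)
    (simp add: monomial_poly_def mult_single)

lemma poly_subst_binomial:
  assumes "mono_map f a = mono_map f b"
  shows "poly_subst (\<lambda>x. monomial_poly (f x)) (monomial_poly a - monomial_poly b :: ('x, 'k::field) mpoly) = 0"
proof (cases "a = b")
  case True
  then show ?thesis by (simp add: poly_subst_def)
next
  case False
  then have "Poly_Mapping.lookup (monomial_poly a - monomial_poly b :: ('x, 'k) mpoly) a = 1"
    "Poly_Mapping.lookup (monomial_poly a - monomial_poly b :: ('x, 'k) mpoly) b = - 1"
    by (auto simp: monomial_poly_def lookup_minus lookup_single)
  with False show ?thesis
    by (simp add: poly_subst_monomials keys_binomial assms flip: single_add)
qed

text \<open>The coefficient of the image at \<open>mono_map f m\<close> is the sum of the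
  coefficients of \<open>p\<close> over the fibre of \<open>m\<close>; a monomial alone in its fibre
  would leave its own nonzero coefficient there.\<close>

lemma poly_subst_eq_zero_partner:
  assumes "poly_subst (\<lambda>x. monomial_poly (f x)) p = 0" "m \<in> Poly_Mapping.keys p"
  obtains m' where "m' \<in> Poly_Mapping.keys p" "m' \<noteq> m" "mono_map f m' = mono_map f m"
proof (rule ccontr)
  assume "\<not> thesis"
  with that have alone: "\<forall>m'\<in>Poly_Mapping.keys p. m' \<noteq> m \<longrightarrow> mono_map f m' \<noteq> mono_map f m" by blast
  have "0 = Poly_Mapping.lookup (poly_subst (\<lambda>x. monomial_poly (f x)) p) (mono_map f m)"
    by (simp add: assms(1))
  also have "\<dots> = (\<Sum>u\<in>Poly_Mapping.keys p. if u = m then Poly_Mapping.lookup p u else 0)"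
    unfolding poly_subst_monomials lookup_sum
    by (rule sum.cong) (use alone in \<open>auto simp: lookup_single\<close>)
  also have "\<dots> = Poly_Mapping.lookup p m" using assms(2) by simp
  finally show False using assms(2) by (simp add: in_keys_iff)
qed

text \<open>Exponents are bounded by the degree. Restricting the exponent functions to
  \<open>X\<close> puts them into a finite function space and loses nothing, as they vanish off
  \<open>X\<close>.\<close>

lemma finite_monomials_of_degree:
  assumes "finite X"
  shows "finite {m \<in> monomials X. mono_degree m = d}"
proof (rule finite_imageD)
  let ?h = "\<lambda>m. restrict (Poly_Mapping.lookup m) X"
  have "Poly_Mapping.lookup m x \<le> mono_degree m" if "m \<in> monomials X" "x \<in> X" for m x
    using that assms by (auto simp: mono_degree_eq_sum[OF assms] monomials_def intro: member_le_sum)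
  then have "?h ` {m \<in> monomials X. mono_degree m = d} \<subseteq> (\<Pi>\<^sub>E x\<in>X. {..d})"
    by (auto simp: PiE_def Pi_def)
  then show "finite (?h ` {m \<in> monomials X. mono_degree m = d})"
    by (rule finite_subset) (use assms in \<open>auto intro: finite_PiE\<close>)
  show "inj_on ?h {m \<in> monomials X. mono_degree m = d}"
  proof (rule inj_onI, rule poly_mapping_eqI)
    fix u v x
    assume u: "u \<in> {m \<in> monomials X. mono_degree m = d}" and v: "v \<in> {m \<in> monomials X. mono_degree m = d}"
      and eq: "?h u = ?h v"
    show "Poly_Mapping.lookup u x = Poly_Mapping.lookup v x"
    proof (cases "x \<in> X")
      case True
      then show ?thesis using fun_cong[OF eq, of x] by simp
    next
      case False
      then have "x \<notin> Poly_Mapping.keys u" "x \<notin> Poly_Mapping.keys v"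
        using u v by (auto simp: monomials_def)
      then show ?thesis by (simp add: in_keys_iff)
    qed
  qed
qed

lemma monomials_factor: "w + a \<in> monomials X \<Longrightarrow> w \<in> monomials X"
  by (auto simp: monomials_def in_keys_iff lookup_add subset_iff)

text \<open>If the initial monomial \<open>m\<close> of a kernel element were standard, then cancellation would provide
  a smaller monomial in its fibre, and the minimum of that fibre would be a second standard monomial
  there.\<close>

theorem toric_groebner_basis:
  fixes f :: "'x \<Rightarrow> 'y mono" and I :: "('x, 'k::field) mpoly set"
  assumes fin: "finite X" and ord: "revlex_order_on X lt"
    and homog: "\<And>u v. u \<in> monomials X \<Longrightarrow> v \<in> monomials X \<Longrightarrow> mono_map f u = mono_map f v \<Longrightarrow>
      mono_degree u = mono_degree v"
    and I: "I = {p \<in> carrier (poly_ring X). poly_subst (\<lambda>x. monomial_poly (f x)) p = 0}"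
    and finP: "finite P"
    and P: "\<And>a b. (a, b) \<in> P \<Longrightarrow>
      a \<in> monomials X \<and> b \<in> monomials X \<and> lt b a \<and> mono_map f a = mono_map f b"
    and standard: "\<And>u v. u \<in> monomials X \<Longrightarrow> v \<in> monomials X \<Longrightarrow> mono_map f u = mono_map f v \<Longrightarrow>
      \<forall>(a, b)\<in>P. \<forall>w. u \<noteq> w + a \<Longrightarrow> \<forall>(a, b)\<in>P. \<forall>w. v \<noteq> w + a \<Longrightarrow> u = v"
  shows "groebner_basis X lt I ((\<lambda>(a, b). monomial_poly a - monomial_poly b) ` P)"
proof -
  let ?B = "(\<lambda>(a, b). monomial_poly a - monomial_poly b) ` P :: ('x, 'k) mpoly set"
  let ?R = "poly_ring X :: ('x, 'k) mpoly ring"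
  have ne: "a \<noteq> b" if "(a, b) \<in> P" for a b using P[OF that] revlex_asym[OF ord] by blast
  have carrier_mono: "monomial_poly m \<in> carrier ?R" if "m \<in> monomials X" for m
    using that by (simp add: poly_ring_def monomial_poly_def)
  have BI: "?B \<subseteq> I"
  proof clarify
    fix a b assume ab: "(a, b) \<in> P"
    show "monomial_poly a - monomial_poly b \<in> I"
      using P[OF ab] ne[OF ab] by (simp add: I poly_subst_binomial poly_ring_def keys_binomial)
  qed
  interpret cring ?R by (rule cring_poly_ring)
  have init_carrier: "initial lt ` (I - {0}) \<subseteq> carrier ?R"
  proof (rule image_subsetI)
    fix p assume "p \<in> I - {0}"
    then have "Poly_Mapping.keys p \<subseteq> monomials X" "p \<noteq> 0" by (auto simp: I poly_ring_def)
    from initial_mono_greatest(1)[OF ord this] this(1) show "initial lt p \<in> carrier ?R"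
      unfolding initial_def by (intro carrier_mono) auto
  qed
  have B_carrier: "initial lt ` (?B - {0}) \<subseteq> carrier ?R" using init_carrier BI by blast
  define J where "J = Idl\<^bsub>?R\<^esub> (initial lt ` (?B - {0}))"
  have J: "ideal J ?R" unfolding J_def by (rule genideal_ideal[OF B_carrier])
  have in_J: "monomial_poly (w + a) \<in> J" if "(a, b) \<in> P" "w + a \<in> monomials X" for a b w
  proof -
    let ?p = "monomial_poly a - monomial_poly b :: ('x, 'k) mpoly"
    have "?p \<in> ?B" using that(1) by force
    moreover have "?p \<noteq> 0" using keys_binomial[OF ne[OF that(1)], where 'k='k] by auto
    ultimately have "initial lt ?p \<in> initial lt ` (?B - {0})" by blast
    then have "initial lt ?p \<in> J"
      unfolding J_def using genideal_self[OF B_carrier] by blast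
    moreover have "initial lt ?p = monomial_poly a"
      using P[OF that(1)] by (intro initial_binomial[OF ord]) auto
    moreover have "monomial_poly w \<in> carrier ?R"
      using carrier_mono monomials_factor[OF that(2)] by blast
    ultimately have "monomial_poly w \<otimes>\<^bsub>?R\<^esub> monomial_poly a \<in> J"
      using ideal.I_l_closed[OF J] by metis
    then show ?thesis by (simp add: poly_ring_def monomial_poly_mult)
  qed
  have "initial lt p \<in> J" if p: "p \<in> I - {0}" for p
  proof (rule ccontr)
    assume notin: "initial lt p \<notin> J"
    have keys: "Poly_Mapping.keys p \<subseteq> monomials X" and "p \<noteq> 0"
      and ker: "poly_subst (\<lambda>x. monomial_poly (f x)) p = 0"
      using p by (auto simp: I poly_ring_def)
    define m where "m = initial_mono lt p"
    have m: "m \<in> Poly_Mapping.keys p" "m \<in> monomials X"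
      and greatest: "\<And>u. u \<in> Poly_Mapping.keys p \<Longrightarrow> u \<noteq> m \<Longrightarrow> lt u m"
      unfolding m_def using initial_mono_greatest[OF ord keys \<open>p \<noteq> 0\<close>] keys by blast+
    obtain m' where m': "m' \<in> Poly_Mapping.keys p" "m' \<noteq> m" "mono_map f m' = mono_map f m"
      using poly_subst_eq_zero_partner[OF ker m(1)] by metis
    define M where "M = {u \<in> monomials X. mono_map f u = mono_map f m}"
    \<comment> \<open>Homogeneity confines the fibre to one degree, so it is finite and has a
      minimal element.\<close>
    have "M \<subseteq> {u \<in> monomials X. mono_degree u = mono_degree m}"
      unfolding M_def using homog[OF _ m(2)] by blast
    then have "finite M" using finite_monomials_of_degree[OF fin] by (rule finite_subset)
    moreover have m'M: "m' \<in> M" using m' keys by (auto simp: M_def)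
    ultimately obtain u where u: "u \<in> M" "\<forall>v\<in>M. \<not> lt v u"
      using revlex_minimal[OF ord, of M] by (auto simp: M_def)
    have "lt m' m" using greatest m' by blast
    then have "u \<noteq> m" using u(2) m'M by blast
    moreover have "\<forall>(a, b)\<in>P. \<forall>w. m \<noteq> w + a"
      using notin in_J m(2) by (auto simp: initial_def simp flip: m_def)
    \<comment> \<open>If \<open>a\<close> divided \<open>u\<close>, replacing it by \<open>b\<close>
      would keep the image and give a smaller element of the fibre.\<close>
    moreover have "\<forall>(a, b)\<in>P. \<forall>w. u \<noteq> w + a"
    proof clarify
      fix a b w assume ab: "(a, b) \<in> P" and u_eq: "u = w + a"
      then have w: "w \<in> monomials X" using u(1) monomials_factor[of w a X] by (simp add: M_def)
      have "w + b \<in> M"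
        using u(1) u_eq P[OF ab] w by (auto simp: M_def mono_map_add intro: monomials_add)
      moreover have "lt (w + b) u" using revlex_add[OF ord] P[OF ab] w u_eq by blast
      ultimately show False using u(2) by blast
    qed
    ultimately show False using standard[of u m] u(1) m(2) by (auto simp: M_def)
  qed
  then have "initial_ideal X lt I \<subseteq> J"
    unfolding initial_ideal_def by (intro genideal_minimal[OF J]) blast
  moreover have "J \<subseteq> initial_ideal X lt I"
    unfolding initial_ideal_def J_def using BI by (intro subset_Idl_subset[OF init_carrier]) blast
  ultimately show ?thesis
    using BI finP by (auto simp: groebner_basis_def J_def)
qed


section \<open>Multisets of subsets forming a chain\<close>

text \<open>A multiset of subsets of \<open>W\<close> is given by its multiplicities. Values off
  \<open>Pow W\<close> are left free, because \<open>sep_cut\<close> and \<open>join_cut\<close>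
  repeat cuts there.\<close>

definition chain_weight :: "'a set \<Rightarrow> ('a set \<Rightarrow> nat) \<Rightarrow> bool" where
  "chain_weight W f \<longleftrightarrow> (\<forall>X Y. X \<subseteq> W \<and> Y \<subseteq> W \<and> f X > 0 \<and> f Y > 0 \<longrightarrow> X \<subseteq> Y \<or> Y \<subseteq> X)"

definition cover :: "'a set \<Rightarrow> ('a set \<Rightarrow> nat) \<Rightarrow> 'a \<Rightarrow> nat" where
  "cover W f j = (\<Sum>X\<in>Pow W. if j \<in> X then f X else 0)"

definition cocover :: "'a set \<Rightarrow> ('a set \<Rightarrow> nat) \<Rightarrow> 'a \<Rightarrow> nat" where
  "cocover W f j = (\<Sum>X\<in>Pow W. if j \<in> X then 0 else f X)"

lemma cover_posE:
  assumes "cover W f j > 0"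
  obtains X where "X \<subseteq> W" "j \<in> X" "f X > 0"
proof -
  have "(\<Sum>X\<in>Pow W. if j \<in> X then f X else 0) \<noteq> 0" using assms by (simp add: cover_def)
  then obtain X where "X \<in> Pow W" "(if j \<in> X then f X else 0) \<noteq> 0"
    by (rule sum.not_neutral_contains_not_neutral)
  then show thesis using that by (auto split: if_splits)
qed

lemma cocover_posE:
  assumes "cocover W f j > 0"
  obtains X where "X \<subseteq> W" "j \<notin> X" "f X > 0"
proof -
  have "(\<Sum>X\<in>Pow W. if j \<in> X then 0 else f X) \<noteq> 0" using assms by (simp add: cocover_def)
  then obtain X where "X \<in> Pow W" "(if j \<in> X then 0 else f X) \<noteq> 0"
    by (rule sum.not_neutral_contains_not_neutral)
  then show thesis using that by (auto split: if_splits)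
qed

lemma cover_cocover: "cover W f j + cocover W f j = sum f (Pow W)"
  unfolding cover_def cocover_def sum.distrib[symmetric] by (rule sum.cong) auto

text \<open>A member containing \<open>i\<close> is not inside \<open>X\<close>, hence contains
  \<open>X\<close> and with it \<open>j\<close>; the member \<open>X\<close> itself makes the
  inequality strict.\<close>

lemma cover_less:
  assumes "finite W" "chain_weight W f" "X \<subseteq> W" "f X > 0" "j \<in> X" "i \<notin> X"
  shows "cover W f i < cover W f j"
  unfolding cover_def
proof (rule sum_strict_mono_ex1)
  have "f Y = 0 \<or> j \<in> Y" if "Y \<subseteq> W" "i \<in> Y" for Y
  proof (cases "f Y = 0")
    case False
    then have "X \<subseteq> Y \<or> Y \<subseteq> X"
      using assms(2-4) that(1) by (simp add: chain_weight_def)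
    then show ?thesis using that(2) assms(5,6) by blast
  qed simp
  then show "\<forall>Y\<in>Pow W. (if i \<in> Y then f Y else 0) \<le> (if j \<in> Y then f Y else 0)"
    by auto
  show "\<exists>Y\<in>Pow W. (if i \<in> Y then f Y else 0) < (if j \<in> Y then f Y else 0)"
    using assms(3-6) by (intro bexI[of _ X]) auto
qed (use assms(1) in simp)

text \<open>A member that contains the least covered \<open>j\<close> but misses some
  \<open>i\<close> in \<open>Y\<close> would contradict minimality by \<open>cover_less\<close>. So
  the members containing \<open>j\<close> are exactly those containing \<open>Y\<close>.\<close>

lemma chain_weight_superset_sum:
  assumes "finite W" "chain_weight W f" "Y \<subseteq> W" "j \<in> Y" "\<And>i. i \<in> Y \<Longrightarrow> cover W f j \<le> cover W f i"
  shows "(\<Sum>X\<in>Pow W. if Y \<subseteq> X then f X else 0) = cover W f j"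
  unfolding cover_def
proof (rule sum.cong)
  fix X assume X: "X \<in> Pow W"
  have "Y \<subseteq> X" if "f X > 0" "j \<in> X"
    using cover_less[OF assms(1,2) _ that] X assms(5) by (metis PowD leD subsetI)
  then show "(if Y \<subseteq> X then f X else 0) = (if j \<in> X then f X else 0)"
    using assms(4) by auto
qed simp

text \<open>The total multiplicity of the supersets of \<open>Y\<close> is known: it is the size of
  the multiset for \<open>Y = {}\<close> and a cover number otherwise. Descending from
  \<open>W\<close>, the proper supersets are already settled and can be subtracted.\<close>

lemma chain_weight_eqI:
  assumes "finite W" "chain_weight W f" "chain_weight W g"
    and total: "sum f (Pow W) = sum g (Pow W)"
    and cover: "\<And>j. j \<in> W \<Longrightarrow> cover W f j = cover W g j"
    and "Y \<subseteq> W"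
  shows "f Y = g Y"
  using \<open>Y \<subseteq> W\<close>
proof (induction "card (W - Y)" arbitrary: Y rule: less_induct)
  case less
  have sums: "(\<Sum>X\<in>Pow W. if Y \<subseteq> X then f X else 0) = (\<Sum>X\<in>Pow W. if Y \<subseteq> X then g X else 0)"
  proof (cases "Y = {}")
    case True
    then show ?thesis using total by simp
  next
    case False
    have "finite Y" using less.prems assms(1) by (rule finite_subset)
    then obtain j where j: "j \<in> Y" "\<And>i. i \<in> Y \<Longrightarrow> cover W f j \<le> cover W f i"
      using False arg_min_if_finite(1)[of Y "cover W f"] arg_min_least[of Y _ "cover W f"] by blast
    \<comment> \<open>The cover numbers agree, so one \<open>j\<close> is least covered for both
      weights.\<close>
    then have "\<And>i. i \<in> Y \<Longrightarrow> cover W g j \<le> cover W g i"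
      using cover less.prems by (metis subsetD)
    then show ?thesis
      using j chain_weight_superset_sum[OF assms(1,2) less.prems j(1)]
        chain_weight_superset_sum[OF assms(1,3) less.prems j(1)] cover less.prems by auto
  qed
  have rest: "(\<Sum>X\<in>Pow W - {Y}. if Y \<subseteq> X then f X else 0) = (\<Sum>X\<in>Pow W - {Y}. if Y \<subseteq> X then g X else 0)"
  proof (rule sum.cong)
    fix X assume X: "X \<in> Pow W - {Y}"
    show "(if Y \<subseteq> X then f X else 0) = (if Y \<subseteq> X then g X else 0)"
    proof (cases "Y \<subseteq> X")
      case True
      then have "W - X \<subset> W - Y" using X by auto
      then have "card (W - X) < card (W - Y)" using assms(1) by (intro psubset_card_mono) auto
      then show ?thesis using less.hyps X by auto
    qed simp
  qed simp
  show ?case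
    using sums rest less.prems assms(1) by (simp add: sum.remove[of "Pow W" Y])
qed

text \<open>\<open>N\<close> records the cuts separating the vertices 1 and 2, \<open>J\<close> the others. If \<open>N\<close> had fewer members
  than \<open>N'\<close>, then every \<open>j\<close> would lie in some but not all members of \<open>N'\<close>, which for a chain forces
  both \<open>{}\<close> and \<open>W\<close> to occur in \<open>N'\<close>.\<close>

lemma chain_weight_total_not_less:
  assumes "finite W" "W \<noteq> {}" "chain_weight W N'" "\<not> (N' {} > 0 \<and> N' W > 0)"
    and co: "\<And>j. j \<in> W \<Longrightarrow> cocover W N j + cocover W J j = cocover W N' j + cocover W J' j"
    and cv: "\<And>j. j \<in> W \<Longrightarrow> cover W N j + cocover W J j = cover W N' j + cocover W J' j"
  shows "\<not> sum N (Pow W) < sum N' (Pow W)"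
proof
  assume less: "sum N (Pow W) < sum N' (Pow W)"
  \<comment> \<open>Subtracting \<open>cv\<close> from \<open>co\<close> shows that
    \<open>cover\<close> and \<open>cocover\<close> both grow from \<open>N\<close> to
    \<open>N'\<close> by the same amount, half of the positive difference of the totals.\<close>
  have pos: "cover W N' j > 0" "cocover W N' j > 0" if "j \<in> W" for j
    using co[OF that] cv[OF that] cover_cocover[of W N j] cover_cocover[of W N' j] less by linarith+
  \<comment> \<open>A member containing a least covered element must be all of
    \<open>W\<close>.\<close>
  obtain j where j: "j \<in> W" "\<And>i. i \<in> W \<Longrightarrow> cover W N' j \<le> cover W N' i"
    using assms(1,2) arg_min_if_finite(1)[of W "cover W N'"] arg_min_least[of W _ "cover W N'"] by blast
  obtain X where X: "X \<subseteq> W" "j \<in> X" "N' X > 0"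
    using pos(1)[OF j(1)] by (rule cover_posE)
  then have "W \<subseteq> X" using cover_less[OF assms(1,3)] j by (metis leD subsetI)
  then have top: "N' W > 0" using X by (metis subset_antisym)
  \<comment> \<open>Dually, a member missing a most covered element must be empty.\<close>
  obtain k where k: "k \<in> W" "\<And>i. i \<in> W \<Longrightarrow> cover W N' i \<le> cover W N' k"
    using assms(1,2) Max_in[of "cover W N' ` W"] Max_ge[of "cover W N' ` W"] by fastforce
  obtain Y where Y: "Y \<subseteq> W" "k \<notin> Y" "N' Y > 0"
    using pos(2)[OF k(1)] by (rule cocover_posE)
  then have "Y = {}" using cover_less[OF assms(1,3)] k by (metis equals0I leD subsetD)
  with Y(3) top assms(4) show False by blast
qed

text \<open>Applying the previous lemma in both directions equates the lengths of the first chains,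
  and \<open>total\<close> those of the second. The equations \<open>co\<close> and
  \<open>cv\<close> then determine all cover numbers.\<close>

lemma chain_weight_pair_eqI:
  assumes "finite W" "W \<noteq> {}"
    and chains: "chain_weight W N" "chain_weight W J" "chain_weight W N'" "chain_weight W J'"
    and ends: "\<not> (N {} > 0 \<and> N W > 0)" "\<not> (N' {} > 0 \<and> N' W > 0)"
    and total: "sum N (Pow W) + sum J (Pow W) = sum N' (Pow W) + sum J' (Pow W)"
    and co: "\<And>j. j \<in> W \<Longrightarrow> cocover W N j + cocover W J j = cocover W N' j + cocover W J' j"
    and cv: "\<And>j. j \<in> W \<Longrightarrow> cover W N j + cocover W J j = cover W N' j + cocover W J' j"
    and "X \<subseteq> W"
  shows "N X = N' X \<and> J X = J' X"
proof -
  have eqN: "sum N (Pow W) = sum N' (Pow W)"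
    using chain_weight_total_not_less[OF assms(1,2) chains(3) ends(2) co cv]
      chain_weight_total_not_less[OF assms(1,2) chains(1) ends(1) co[symmetric] cv[symmetric]]
    by linarith
  then have eqJ: "sum J (Pow W) = sum J' (Pow W)" using total by simp
  have "cover W N j = cover W N' j" "cover W J j = cover W J' j" if "j \<in> W" for j
    using co[OF that] cv[OF that] cover_cocover[of W N j] cover_cocover[of W N' j]
      cover_cocover[of W J j] cover_cocover[of W J' j] eqN eqJ by linarith+
  then show ?thesis
    using chain_weight_eqI[OF assms(1)] chains eqN eqJ \<open>X \<subseteq> W\<close> by metis
qed


section \<open>Cuts of \<open>K\<^bsub>2,n-2\<^esub>\<close>\<close>

declare One_nat_def [simp del]

definition sep_cut :: "nat \<Rightarrow> nat set \<Rightarrow> nat set set" where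
  "sep_cut n X = {insert 1 X, insert 2 ({3..n} - X)}"

text \<open>The extreme traces \<open>{}\<close> and \<open>{3..n}\<close> give the two cuts in the
  second monomial of (i).\<close>

definition join_cut :: "nat \<Rightarrow> nat set \<Rightarrow> nat set set" where
  "join_cut n X = {insert 1 (insert 2 X), {3..n} - X}"

text \<open>The two sides are unordered, but only one contains 1; intersecting that side with
  \<open>{3..n}\<close> recovers the trace.\<close>

lemma inj_sep_cut: "inj_on (sep_cut n) (Pow {3..n})"
proof (rule inj_onI)
  fix X Y assume X: "X \<in> Pow {3..n}" and Y: "Y \<in> Pow {3..n}" and "sep_cut n X = sep_cut n Y"
  moreover have "1 \<notin> insert 2 ({3..n} - Y)" by auto
  ultimately have "insert 1 X = insert 1 Y"
    unfolding sep_cut_def doubleton_eq_iff by blast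
  moreover have "Z = insert 1 Z \<inter> {3..n}" if "Z \<in> Pow {3..n}" for Z using that by auto
  ultimately show "X = Y" using X Y by metis
qed

lemma inj_join_cut: "inj_on (join_cut n) (Pow {3..n})"
proof (rule inj_onI)
  fix X Y assume X: "X \<in> Pow {3..n}" and Y: "Y \<in> Pow {3..n}" and "join_cut n X = join_cut n Y"
  moreover have "1 \<notin> {3..n} - Y" by auto
  ultimately have "insert 1 (insert 2 X) = insert 1 (insert 2 Y)"
    unfolding join_cut_def doubleton_eq_iff by blast
  moreover have "Z = insert 1 (insert 2 Z) \<inter> {3..n}" if "Z \<in> Pow {3..n}" for Z using that by auto
  ultimately show "X = Y" using X Y by metis
qed

lemma sep_join_disjoint:
  assumes "X \<subseteq> {3..n}"
  shows "sep_cut n X \<noteq> join_cut n Y"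
proof -
  have "2 \<notin> insert 1 X" "1 \<notin> insert 2 ({3..n} - X)"
    using assms by auto
  then have "insert 1 (insert 2 Y) \<notin> sep_cut n X"
    unfolding sep_cut_def by (metis insertCI insertE singletonD)
  moreover have "insert 1 (insert 2 Y) \<in> join_cut n Y" by (simp add: join_cut_def)
  ultimately show ?thesis by blast
qed

lemma bipartition_sep:
  fixes n :: nat
  assumes "n \<ge> 2" "X \<subseteq> {3..n}"
  shows "bipartition {1..n} (insert 1 X) (insert 2 ({3..n} - X))"
  using assms by (auto simp: bipartition_def)

lemma bipartition_join:
  fixes n :: nat
  assumes "n \<ge> 2" "X \<subseteq> {3..n}"
  shows "bipartition {1..n} (insert 1 (insert 2 X)) ({3..n} - X)"
  using assms by (auto simp: bipartition_def)

lemma bipartition_cut: "bipartition V A B \<Longrightarrow> {A, B} \<in> cuts V"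
  by (auto simp: cuts_def)

lemma cuts_eq:
  fixes n :: nat
  assumes "n \<ge> 2"
  shows "cuts {1..n} = sep_cut n ` Pow {3..n} \<union> join_cut n ` Pow {3..n}"
proof
  show "sep_cut n ` Pow {3..n} \<union> join_cut n ` Pow {3..n} \<subseteq> cuts {1..n}"
    using bipartition_sep[OF assms] bipartition_join[OF assms]
    by (auto simp: sep_cut_def join_cut_def intro: bipartition_cut)
  \<comment> \<open>Since cuts are unordered, the side containing 1 may be called \<open>A\<close>;
    the position of 2 then selects the encoding.\<close>
  have *: "{A, B} \<in> sep_cut n ` Pow {3..n} \<union> join_cut n ` Pow {3..n}"
    if "bipartition {1..n} A B" "1 \<in> A" for A B
  proof (cases "2 \<in> A")
    case True
    then have "A = insert 1 (insert 2 (A \<inter> {3..n}))" "B = {3..n} - (A \<inter> {3..n})"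
      using that assms by (auto simp: bipartition_def set_eq_iff) (metis (full_types) le_antisym not_less_eq_eq numeral_2_eq_2 numeral_3_eq_3 One_nat_def)+
    then have "{A, B} = join_cut n (A \<inter> {3..n})" by (metis join_cut_def)
    then show ?thesis by blast
  next
    case False
    then have "A = insert 1 (A \<inter> {3..n})" "B = insert 2 ({3..n} - (A \<inter> {3..n}))"
      using that assms by (auto simp: bipartition_def set_eq_iff) (metis (full_types) le_antisym not_less_eq_eq numeral_2_eq_2 numeral_3_eq_3 One_nat_def)+
    then have "{A, B} = sep_cut n (A \<inter> {3..n})" by (metis sep_cut_def)
    then show ?thesis by blast
  qed
  show "cuts {1..n} \<subseteq> sep_cut n ` Pow {3..n} \<union> join_cut n ` Pow {3..n}"
  proof
    fix c assume "c \<in> cuts {1..n}"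
    then obtain A B where c: "c = {A, B}" and AB: "bipartition {1..n} A B" by (auto simp: cuts_def)
    then have BA: "bipartition {1..n} B A" by (auto simp: bipartition_def)
    have "1 \<in> {1..n}" using assms by simp
    then have "1 \<in> A \<or> 1 \<in> B" using AB unfolding bipartition_def by blast
    then show "c \<in> sep_cut n ` Pow {3..n} \<union> join_cut n ` Pow {3..n}"
      using *[OF AB] *[OF BA] c insert_commute[of A B "{}"] by auto
  qed
qed

lemma finite_cuts: "n \<ge> 2 \<Longrightarrow> finite (cuts {1..n::nat})"
  by (simp add: cuts_eq)

lemma sum_cuts:
  fixes n :: nat
  assumes "n \<ge> 2"
  shows "(\<Sum>c\<in>cuts {1..n}. g c) =
    (\<Sum>X\<in>Pow {3..n}. g (sep_cut n X)) + (\<Sum>X\<in>Pow {3..n}. g (join_cut n X))"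
proof -
  have "sep_cut n ` Pow {3..n} \<inter> join_cut n ` Pow {3..n} = {}"
    by (auto dest: sep_join_disjoint)
  then show ?thesis
    unfolding cuts_eq[OF assms]
    by (simp add: sum.union_disjoint sum.reindex[OF inj_sep_cut] sum.reindex[OF inj_join_cut])
qed

section \<open>Edges of the bipartite graph and exponents of image monomials\<close>

abbreviation (input) K2_edges :: "nat \<Rightarrow> nat set set" where
  "K2_edges n \<equiv> complete_bipartite_edges {1, 2} {3..n}"

lemma finite_K2_edges: "finite (K2_edges n)"
proof -
  have "K2_edges n \<subseteq> (\<lambda>(i, j). {i, j}) ` ({1, 2} \<times> {3..n})"
    by (auto simp: complete_bipartite_edges_def)
  then show ?thesis by (rule finite_subset) simp
qed

lemma K2_edgeE:
  assumes "e \<in> K2_edges n"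
  obtains i j where "e = {i, j}" "i = 1 \<or> i = 2" "j \<in> {3..n}"
  using assms by (auto simp: complete_bipartite_edges_def)

lemma K2_cut_edge_iff:
  fixes n :: nat
  assumes "bipartition {1..n} A B" "i = 1 \<or> i = 2" "j \<in> {3..n}"
  shows "{i, j} \<in> cut_edges (K2_edges n) {A, B} \<longleftrightarrow> (i \<in> A \<longleftrightarrow> j \<notin> A)"
proof -
  have "\<forall>e\<in>K2_edges n. e \<subseteq> {1..n} \<and> card e = 2"
    by (auto elim!: K2_edgeE simp: card_insert_if)
  moreover have "{i, j} \<in> K2_edges n" using assms(2,3) by (auto simp: complete_bipartite_edges_def)
  ultimately have "{i, j} \<in> cut_edges (K2_edges n) {A, B} \<longleftrightarrow> card (A \<inter> {i, j}) = 1"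
    using cut_edges_bipartition[OF _ _ assms(1)] by simp
  also have "\<dots> \<longleftrightarrow> (i \<in> A \<longleftrightarrow> j \<notin> A)"
    using assms(2,3) by (auto simp: Int_insert_right card_insert_if)
  finally show ?thesis .
qed

definition cut_mono :: "'v set set \<Rightarrow> 'v set set \<Rightarrow> 'v st_var mono" where
  "cut_mono E c = mvar S + (\<Sum>e\<in>cut_edges E c. mvar (T e))"

lemma cut_hom_eq: "cut_hom E = poly_subst (\<lambda>c. monomial_poly (cut_mono E c))"
  by (simp add: cut_hom_def cut_mono_def monomial_poly_prod monomial_poly_mult)

lemma lookup_cut_mono_S: "Poly_Mapping.lookup (cut_mono E c) S = 1"
  by (simp add: cut_mono_def mvar_def lookup_add lookup_sum lookup_single)

lemma lookup_cut_mono_T: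
  assumes "finite E"
  shows "Poly_Mapping.lookup (cut_mono E c) (T e) = (if e \<in> cut_edges E c then 1 else 0)"
proof -
  have "finite (cut_edges E c)" using assms by (simp add: cut_edges_def)
  then show ?thesis
    by (simp add: cut_mono_def mvar_def lookup_add lookup_sum lookup_single when_def)
qed

text \<open>Membership of a quadratic binomial in the cut ideal becomes a count, edge by edge, of
  how many of its two cuts separate the endpoints; the exponents of \<open>S\<close> always
  match.\<close>

lemma cut_mono_add_eqI:
  fixes n :: nat
  assumes "bipartition {1..n} A B" "bipartition {1..n} C D" "bipartition {1..n} A' B'" "bipartition {1..n} C' D'"
    and "\<And>i j. i = 1 \<or> i = 2 \<Longrightarrow> j \<in> {3..n} \<Longrightarrow>
      of_bool (i \<in> A \<longleftrightarrow> j \<notin> A) + of_bool (i \<in> C \<longleftrightarrow> j \<notin> C) =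
      (of_bool (i \<in> A' \<longleftrightarrow> j \<notin> A') + of_bool (i \<in> C' \<longleftrightarrow> j \<notin> C') :: nat)"
  shows "cut_mono (K2_edges n) {A, B} + cut_mono (K2_edges n) {C, D} =
    cut_mono (K2_edges n) {A', B'} + cut_mono (K2_edges n) {C', D'}"
proof (rule poly_mapping_eqI)
  fix y
  show "Poly_Mapping.lookup (cut_mono (K2_edges n) {A, B} + cut_mono (K2_edges n) {C, D}) y =
    Poly_Mapping.lookup (cut_mono (K2_edges n) {A', B'} + cut_mono (K2_edges n) {C', D'}) y"
  proof (cases y)
    case S
    then show ?thesis by (simp add: lookup_add lookup_cut_mono_S)
  next
    case (T e)
    show ?thesis
    proof (cases "e \<in> K2_edges n")
      case True
      then obtain i j where e: "e = {i, j}" "i = 1 \<or> i = 2" "j \<in> {3..n}" by (rule K2_edgeE)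
      show ?thesis
        using assms(5)[OF e(2,3)]
        unfolding T e(1) lookup_add lookup_cut_mono_T[OF finite_K2_edges]
          K2_cut_edge_iff[OF assms(1) e(2,3)] K2_cut_edge_iff[OF assms(2) e(2,3)]
          K2_cut_edge_iff[OF assms(3) e(2,3)] K2_cut_edge_iff[OF assms(4) e(2,3)] of_bool_def .
    next
      case False
      then show ?thesis
        by (simp add: T lookup_add lookup_cut_mono_T[OF finite_K2_edges] cut_edges_def)
    qed
  qed
qed

lemma cut_edge_sep:
  fixes n :: nat
  assumes "n \<ge> 2" "X \<subseteq> {3..n}" "j \<in> {3..n}"
  shows "{1, j} \<in> cut_edges (K2_edges n) (sep_cut n X) \<longleftrightarrow> j \<notin> X"
    and "{2, j} \<in> cut_edges (K2_edges n) (sep_cut n X) \<longleftrightarrow> j \<in> X"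
  using assms(2,3) unfolding sep_cut_def
  by (subst K2_cut_edge_iff[OF bipartition_sep[OF assms(1,2)]]; auto)+

lemma cut_edge_join:
  fixes n :: nat
  assumes "n \<ge> 2" "X \<subseteq> {3..n}" "j \<in> {3..n}" "i = 1 \<or> i = 2"
  shows "{i, j} \<in> cut_edges (K2_edges n) (join_cut n X) \<longleftrightarrow> j \<notin> X"
  using assms(2-4) unfolding join_cut_def
  by (subst K2_cut_edge_iff[OF bipartition_join[OF assms(1,2)]]; auto)

text \<open>A separating cut cuts exactly one of the edges 1j and 2j, so \<open>N\<close> enters the
  two exponents through complementary counts. A joining cut treats both edges alike, so
  \<open>J\<close> enters through the same count twice.\<close>

lemma lookup_mono_map_cuts:
  fixes n :: nat
  assumes "n \<ge> 2" "m \<in> monomials (cuts {1..n})"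
  defines "N \<equiv> \<lambda>X. Poly_Mapping.lookup m (sep_cut n X)" and "J \<equiv> \<lambda>X. Poly_Mapping.lookup m (join_cut n X)"
  shows "Poly_Mapping.lookup (mono_map (cut_mono (K2_edges n)) m) S = sum N (Pow {3..n}) + sum J (Pow {3..n})"
    and "j \<in> {3..n} \<Longrightarrow> Poly_Mapping.lookup (mono_map (cut_mono (K2_edges n)) m) (T {1, j}) =
      cocover {3..n} N j + cocover {3..n} J j"
    and "j \<in> {3..n} \<Longrightarrow> Poly_Mapping.lookup (mono_map (cut_mono (K2_edges n)) m) (T {2, j}) =
      cover {3..n} N j + cocover {3..n} J j"
proof -
  have keys: "Poly_Mapping.keys m \<subseteq> cuts {1..n}" using assms(2) by (simp add: monomials_def)
  note lk = lookup_mono_map[OF finite_cuts[OF assms(1)] keys] sum_cuts[OF assms(1)]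
  show "Poly_Mapping.lookup (mono_map (cut_mono (K2_edges n)) m) S = sum N (Pow {3..n}) + sum J (Pow {3..n})"
    by (simp add: lk lookup_cut_mono_S N_def J_def)
  show "Poly_Mapping.lookup (mono_map (cut_mono (K2_edges n)) m) (T {1, j}) =
      cocover {3..n} N j + cocover {3..n} J j" if j: "j \<in> {3..n}"
    unfolding lk cocover_def N_def J_def lookup_cut_mono_T[OF finite_K2_edges]
    by (intro arg_cong2[of _ _ _ _ "(+)"] sum.cong refl)
      (use assms(1) j in \<open>auto simp: cut_edge_sep cut_edge_join\<close>)
  show "Poly_Mapping.lookup (mono_map (cut_mono (K2_edges n)) m) (T {2, j}) =
      cover {3..n} N j + cocover {3..n} J j" if j: "j \<in> {3..n}"
    unfolding lk cocover_def cover_def N_def J_def lookup_cut_mono_T[OF finite_K2_edges]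
    by (intro arg_cong2[of _ _ _ _ "(+)"] sum.cong refl)
      (use assms(1) j in \<open>auto simp: cut_edge_sep cut_edge_join\<close>)
qed

section \<open>The three families, as pairs of the initial and the other monomial\<close>

definition flip_pairs :: "nat \<Rightarrow> (nat set set mono \<times> nat set set mono) set" where
  "flip_pairs n = {(mvar {A, B} + mvar {(B \<union> {1}) - {2}, (A \<union> {2}) - {1}},
      mvar {{}, {1..n}} + mvar {{1, 2}, {3..n}}) | A B.
    bipartition {1..n} A B \<and> 1 \<in> A \<and> 2 \<in> B}"

definition exchange :: "'v set \<Rightarrow> 'v set \<Rightarrow> 'v set \<Rightarrow> 'v set \<Rightarrow> 'v set set mono \<times> 'v set set mono" where
  "exchange A B C D = (mvar {A, B} + mvar {C, D}, mvar {A \<inter> C, B \<union> D} + mvar {A \<union> C, B \<inter> D})"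

definition sep_pairs :: "nat \<Rightarrow> (nat set set mono \<times> nat set set mono) set" where
  "sep_pairs n = {exchange A B C D | A B C D.
    bipartition {1..n} A B \<and> bipartition {1..n} C D \<and>
    1 \<in> A \<inter> C \<and> 2 \<in> B \<inter> D \<and> \<not> A \<subseteq> C \<and> \<not> C \<subseteq> A}"

definition join_pairs :: "nat \<Rightarrow> (nat set set mono \<times> nat set set mono) set" where
  "join_pairs n = {exchange A B C D | A B C D.
    bipartition {1..n} A B \<and> bipartition {1..n} C D \<and>
    1 \<in> A \<inter> C \<and> 2 \<in> A \<inter> C \<and> \<not> A \<subseteq> C \<and> \<not> C \<subseteq> A}"

text \<open>What the toric criterion asks of a pair, together with the degree, from which the
  finiteness of the families follows.\<close>

definition binomial_pair ::
    "nat \<Rightarrow> (nat set set mono \<Rightarrow> nat set set mono \<Rightarrow> bool) \<Rightarrow> nat set set mono \<times> nat set set mono \<Rightarrow> bool" where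
  "binomial_pair n lt = (\<lambda>(a, b). a \<in> monomials (cuts {1..n}) \<and> b \<in> monomials (cuts {1..n}) \<and>
    mono_degree a = 2 \<and> mono_degree b = 2 \<and> lt b a \<and>
    mono_map (cut_mono (K2_edges n)) a = mono_map (cut_mono (K2_edges n)) b)"

text \<open>The cuts of the first monomial have complementary traces on \<open>{3..n}\<close> and
  together cut every edge once; in the second monomial \<open>{1, 2}\<close> against
  \<open>{3..n}\<close> does this alone. The empty cut has a side of size 0, while all four sides in
  the first monomial are nonempty, so it lies below both cuts there.\<close>

lemma flip_pairs_binomial:
  assumes n: "n \<ge> 3" and ord: "revlex_order_on (cuts {1..n}) lt"
    and small: "\<And>A B C D. bipartition {1..n} A B \<Longrightarrow> bipartition {1..n} C D \<Longrightarrow>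
      min (card A) (card B) < min (card C) (card D) \<Longrightarrow> lt (mvar {A, B}) (mvar {C, D})"
    and p: "p \<in> flip_pairs n"
  shows "binomial_pair n lt p"
proof -
  obtain A B where AB: "bipartition {1..n} A B" "1 \<in> A" "2 \<in> B"
    and p_eq: "p = (mvar {A, B} + mvar {(B \<union> {1}) - {2}, (A \<union> {2}) - {1}},
      mvar {{}, {1..n}} + mvar {{1, 2}, {3..n}})"
    using p by (auto simp: flip_pairs_def)
  let ?E = "(B \<union> {1}) - {2}" and ?F = "(A \<union> {2}) - {1}"
  have fin: "finite A" "finite B" using AB(1) by (auto simp: bipartition_def intro: finite_subset)
  have EF: "bipartition {1..n} ?E ?F"
    unfolding bipartition_def
  proof
    have "A \<inter> B = {}" using AB(1) by (simp add: bipartition_def)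
    then show "?E \<inter> ?F = {}" by auto
    have "?E \<union> ?F = A \<union> B" using AB(2,3) by auto
    then show "?E \<union> ?F = {1..n}" using AB(1) by (simp add: bipartition_def)
  qed
  have V: "bipartition {1..n} {} {1..n}" "bipartition {1..n} {1, 2} {3..n}"
    using n by (auto simp: bipartition_def)
  have "1 \<in> ?E" "2 \<in> ?F" by auto
  then have "0 < card A" "0 < card B" "0 < card ?E" "0 < card ?F"
    using AB(2,3) fin by (simp_all only: card_gt_0_iff finite_Diff finite_Un finite.intros) blast+
  then have less: "lt (mvar {{}, {1..n}}) (mvar {A, B})" "lt (mvar {{}, {1..n}}) (mvar {?E, ?F})"
    using small[OF V(1) AB(1)] small[OF V(1) EF] by simp_all
  have "lt (mvar {{}, {1..n}} + mvar {{1, 2}, {3..n}}) (mvar {A, B} + mvar {?E, ?F})"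
    by (intro revlex_mvar_less[OF ord _ less]) (use AB EF V in \<open>auto intro: bipartition_cut\<close>)
  moreover have "cut_mono (K2_edges n) {A, B} + cut_mono (K2_edges n) {?E, ?F} =
      cut_mono (K2_edges n) {{}, {1..n}} + cut_mono (K2_edges n) {{1, 2}, {3..n}}"
  proof (rule cut_mono_add_eqI[OF AB(1) EF V])
    fix i j :: nat assume ij: "i = 1 \<or> i = 2" "j \<in> {3..n}"
    have "1 \<notin> B" "2 \<notin> A" "j \<in> A \<longleftrightarrow> j \<notin> B" "j \<noteq> 1" "j \<noteq> 2"
      using AB ij(2) unfolding bipartition_def by auto
    then show "of_bool (i \<in> A \<longleftrightarrow> j \<notin> A) + of_bool (i \<in> ?E \<longleftrightarrow> j \<notin> ?E) =
      (of_bool (i \<in> {} \<longleftrightarrow> j \<notin> {}) + of_bool (i \<in> {1, 2} \<longleftrightarrow> j \<notin> {1, 2}) :: nat)"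
      using AB(2,3) ij(1) by auto
  qed
  ultimately show ?thesis
    using bipartition_cut[OF AB(1)] bipartition_cut[OF EF] V[THEN bipartition_cut]
    by (simp add: binomial_pair_def p_eq monomials_add monomials_mvar mono_degree_add mono_map_add mono_map_mvar)
qed

text \<open>By incomparability \<open>A \<inter> C\<close> is smaller than \<open>A\<close> and
  \<open>C\<close>, and \<open>B \<inter> D\<close> smaller than \<open>B\<close> and
  \<open>D\<close>. Whichever intersection is the smaller therefore belongs to a cut below both cuts
  of the first monomial. The images agree because 1 and 2 keep their sides, and intersection and
  union together contain each j as often as \<open>A\<close> and \<open>C\<close> do.\<close>

lemma exchange_binomial:
  assumes ord: "revlex_order_on (cuts {1..n}) lt"
    and small: "\<And>A B C D. bipartition {1..n} A B \<Longrightarrow> bipartition {1..n} C D \<Longrightarrow>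
      min (card A) (card B) < min (card C) (card D) \<Longrightarrow> lt (mvar {A, B}) (mvar {C, D})"
    and AB: "bipartition {1..n} A B" and CD: "bipartition {1..n} C D"
    and mem: "1 \<in> A \<inter> C" "2 \<in> A \<longleftrightarrow> 2 \<in> C"
    and inc: "\<not> A \<subseteq> C" "\<not> C \<subseteq> A"
  shows "binomial_pair n lt (exchange A B C D)"
proof -
  have M: "bipartition {1..n} (A \<inter> C) (B \<union> D)" and M': "bipartition {1..n} (A \<union> C) (B \<inter> D)"
    using AB CD unfolding bipartition_def by blast+
  have fin: "finite A" "finite B" "finite C" "finite D"
    using AB CD by (auto simp: bipartition_def intro: finite_subset)
  have "A \<inter> C \<subset> A" "A \<inter> C \<subset> C" "B \<inter> D \<subset> B" "B \<inter> D \<subset> D"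
    using AB CD inc unfolding bipartition_def by blast+
  then have card_less: "card (A \<inter> C) < card A" "card (A \<inter> C) < card C"
      "card (B \<inter> D) < card B" "card (B \<inter> D) < card D"
    using fin by (auto intro: psubset_card_mono)
  have cuts: "{{A, B}, {C, D}, {A \<inter> C, B \<union> D}, {A \<union> C, B \<inter> D}} \<subseteq> cuts {1..n}"
    using AB CD M M' by (auto intro: bipartition_cut)
  have "lt (mvar {A \<inter> C, B \<union> D} + mvar {A \<union> C, B \<inter> D}) (mvar {A, B} + mvar {C, D})"
  proof (cases "card (A \<inter> C) \<le> card (B \<inter> D)")
    case True
    then have "lt (mvar {A \<inter> C, B \<union> D}) (mvar {A, B})" "lt (mvar {A \<inter> C, B \<union> D}) (mvar {C, D})"
      using card_less by (auto intro!: small M AB CD)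
    then show ?thesis using cuts by (intro revlex_mvar_less[OF ord]) auto
  next
    case False
    then have "lt (mvar {A \<union> C, B \<inter> D}) (mvar {A, B})" "lt (mvar {A \<union> C, B \<inter> D}) (mvar {C, D})"
      using card_less by (auto intro!: small M' AB CD)
    then show ?thesis
      unfolding add.commute[of "mvar {A \<inter> C, B \<union> D}"] using cuts
      by (intro revlex_mvar_less[OF ord]) auto
  qed
  moreover have "cut_mono (K2_edges n) {A, B} + cut_mono (K2_edges n) {C, D} =
      cut_mono (K2_edges n) {A \<inter> C, B \<union> D} + cut_mono (K2_edges n) {A \<union> C, B \<inter> D}"
    by (rule cut_mono_add_eqI[OF AB CD M M']) (use mem in auto)
  ultimately show ?thesis
    using cuts
    by (simp add: binomial_pair_def exchange_def monomials_add monomials_mvar mono_degree_add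
        mono_map_add mono_map_mvar)
qed

section \<open>Standard monomials and their recovery from the image\<close>

lemma mvar_pair_factor:
  assumes "Poly_Mapping.lookup u c > 0" "Poly_Mapping.lookup u d > 0" "c \<noteq> d"
  shows "\<exists>w. u = w + (mvar c + mvar d)"
proof
  \<comment> \<open>As \<open>c\<close> and \<open>d\<close> differ, positive exponents make the
    truncated subtraction exact.\<close>
  show "u = (u - (mvar c + mvar d)) + (mvar c + mvar d)"
    by (rule poly_mapping_eqI)
      (use assms in \<open>auto simp: lookup_add lookup_minus mvar_def lookup_single when_def\<close>)
qed

text \<open>Incomparable separating traces would give a divisor from (ii), incomparable joining
  traces one from (iii), and the end pair the divisor from (i) with \<open>A = {1}\<close>.
  Injectivity of the encodings makes the two variables distinct.\<close>

lemma standard_monomial: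
  assumes n: "n \<ge> 3"
    and standard: "\<forall>(a, b)\<in>flip_pairs n \<union> sep_pairs n \<union> join_pairs n. \<forall>w. u \<noteq> w + a"
  shows "chain_weight {3..n} (\<lambda>X. Poly_Mapping.lookup u (sep_cut n X))"
    and "chain_weight {3..n} (\<lambda>X. Poly_Mapping.lookup u (join_cut n X))"
    and "\<not> (Poly_Mapping.lookup u (sep_cut n {}) > 0 \<and> Poly_Mapping.lookup u (sep_cut n {3..n}) > 0)"
proof -
  have n2: "n \<ge> 2" using n by simp
  have no_factor: False
    if "Poly_Mapping.lookup u c > 0" "Poly_Mapping.lookup u d > 0" "c \<noteq> d"
      "(mvar c + mvar d, b) \<in> flip_pairs n \<union> sep_pairs n \<union> join_pairs n" for c d b
    using mvar_pair_factor[OF that(1-3)] bspec[OF standard that(4)] by auto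
  show "chain_weight {3..n} (\<lambda>X. Poly_Mapping.lookup u (sep_cut n X))"
    unfolding chain_weight_def
  proof (intro allI impI, rule ccontr)
    fix X Y
    assume "X \<subseteq> {3..n} \<and> Y \<subseteq> {3..n} \<and> Poly_Mapping.lookup u (sep_cut n X) > 0 \<and>
      Poly_Mapping.lookup u (sep_cut n Y) > 0" and "\<not> (X \<subseteq> Y \<or> Y \<subseteq> X)"
    then have XY: "X \<subseteq> {3..n}" "Y \<subseteq> {3..n}" "Poly_Mapping.lookup u (sep_cut n X) > 0"
      "Poly_Mapping.lookup u (sep_cut n Y) > 0" "\<not> X \<subseteq> Y" "\<not> Y \<subseteq> X" by auto
    then have "\<not> insert 1 X \<subseteq> insert 1 Y" "\<not> insert 1 Y \<subseteq> insert 1 X" by force+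
    then have "exchange (insert 1 X) (insert 2 ({3..n} - X)) (insert 1 Y) (insert 2 ({3..n} - Y)) \<in> sep_pairs n"
      unfolding sep_pairs_def using bipartition_sep[OF n2 XY(1)] bipartition_sep[OF n2 XY(2)] by blast
    then obtain b where "(mvar (sep_cut n X) + mvar (sep_cut n Y), b) \<in> sep_pairs n"
      by (simp add: exchange_def sep_cut_def)
    moreover have "sep_cut n X \<noteq> sep_cut n Y" using inj_onD[OF inj_sep_cut] XY by blast
    ultimately show False using no_factor[OF XY(3,4)] by blast
  qed
  show "chain_weight {3..n} (\<lambda>X. Poly_Mapping.lookup u (join_cut n X))"
    unfolding chain_weight_def
  proof (intro allI impI, rule ccontr)
    fix X Y
    assume "X \<subseteq> {3..n} \<and> Y \<subseteq> {3..n} \<and> Poly_Mapping.lookup u (join_cut n X) > 0 \<and>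
      Poly_Mapping.lookup u (join_cut n Y) > 0" and "\<not> (X \<subseteq> Y \<or> Y \<subseteq> X)"
    then have XY: "X \<subseteq> {3..n}" "Y \<subseteq> {3..n}" "Poly_Mapping.lookup u (join_cut n X) > 0"
      "Poly_Mapping.lookup u (join_cut n Y) > 0" "\<not> X \<subseteq> Y" "\<not> Y \<subseteq> X" by auto
    then have "\<not> insert 1 (insert 2 X) \<subseteq> insert 1 (insert 2 Y)" "\<not> insert 1 (insert 2 Y) \<subseteq> insert 1 (insert 2 X)"
      by force+
    then have "exchange (insert 1 (insert 2 X)) ({3..n} - X) (insert 1 (insert 2 Y)) ({3..n} - Y) \<in> join_pairs n"
      unfolding join_pairs_def using bipartition_join[OF n2 XY(1)] bipartition_join[OF n2 XY(2)] by blast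
    then obtain b where "(mvar (join_cut n X) + mvar (join_cut n Y), b) \<in> join_pairs n"
      by (simp add: exchange_def join_cut_def)
    moreover have "join_cut n X \<noteq> join_cut n Y" using inj_onD[OF inj_join_cut] XY by blast
    ultimately show False using no_factor[OF XY(3,4)] by blast
  qed
  show "\<not> (Poly_Mapping.lookup u (sep_cut n {}) > 0 \<and> Poly_Mapping.lookup u (sep_cut n {3..n}) > 0)"
  proof
    assume pos: "Poly_Mapping.lookup u (sep_cut n {}) > 0 \<and> Poly_Mapping.lookup u (sep_cut n {3..n}) > 0"
    \<comment> \<open>For \<open>A = {1}\<close> the flipped cut isolates 2, that is, it has the
      full trace \<open>{3..n}\<close>.\<close>
    have "bipartition {1..n} {1} (insert 2 {3..n})" using bipartition_sep[OF n2, of "{}"] by simp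
    then have "(mvar {{1}, insert 2 {3..n}} + mvar {(insert 2 {3..n} \<union> {1}) - {2}, ({1} \<union> {2}) - {1}},
        mvar {{}, {1..n}} + mvar {{1, 2}, {3..n}}) \<in> flip_pairs n"
      unfolding flip_pairs_def by blast
    moreover have "(insert 2 {3..n} \<union> {1}) - {2} = insert 1 {3..n}" "({1} \<union> {2}) - {1} = {2::nat}" by auto
    ultimately have "(mvar (sep_cut n {}) + mvar (sep_cut n {3..n}),
        mvar {{}, {1..n}} + mvar {{1, 2}, {3..n}}) \<in> flip_pairs n"
      by (simp add: sep_cut_def)
    moreover have "sep_cut n {} \<noteq> sep_cut n {3..n}"
      using inj_onD[OF inj_sep_cut, of n "{}" "{3..n}"] n by auto
    ultimately show False using no_factor pos by blast
  qed
qed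

lemma standard_monomial_eqI:
  assumes n: "n \<ge> 3"
    and u: "u \<in> monomials (cuts {1..n})" and v: "v \<in> monomials (cuts {1..n})"
    and eq: "mono_map (cut_mono (K2_edges n)) u = mono_map (cut_mono (K2_edges n)) v"
    and su: "\<forall>(a, b)\<in>flip_pairs n \<union> sep_pairs n \<union> join_pairs n. \<forall>w. u \<noteq> w + a"
    and sv: "\<forall>(a, b)\<in>flip_pairs n \<union> sep_pairs n \<union> join_pairs n. \<forall>w. v \<noteq> w + a"
  shows "u = v"
proof (rule poly_mapping_eqI)
  fix c
  have n2: "n \<ge> 2" using n by simp
  \<comment> \<open>The exponents of \<open>S\<close>, \<open>T {1, j}\<close> and
    \<open>T {2, j}\<close> in the common image are the counts compared by
    \<open>chain_weight_pair_eqI\<close>.\<close>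
  have same: "Poly_Mapping.lookup u (sep_cut n X) = Poly_Mapping.lookup v (sep_cut n X) \<and>
      Poly_Mapping.lookup u (join_cut n X) = Poly_Mapping.lookup v (join_cut n X)" if "X \<subseteq> {3..n}" for X
  proof (rule chain_weight_pair_eqI[where W = "{3..n}"
        and N = "\<lambda>X. Poly_Mapping.lookup u (sep_cut n X)" and N' = "\<lambda>X. Poly_Mapping.lookup v (sep_cut n X)"
        and J = "\<lambda>X. Poly_Mapping.lookup u (join_cut n X)" and J' = "\<lambda>X. Poly_Mapping.lookup v (join_cut n X)"])
  qed (use n that standard_monomial[OF n su] standard_monomial[OF n sv]
      in \<open>simp_all flip: lookup_mono_map_cuts[OF n2 u] lookup_mono_map_cuts[OF n2 v] add: eq\<close>)
  show "Poly_Mapping.lookup u c = Poly_Mapping.lookup v c"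
  proof (cases "c \<in> cuts {1..n}")
    case True
    then show ?thesis using same by (auto simp: cuts_eq[OF n2])
  next
    case False
    then have "c \<notin> Poly_Mapping.keys u" "c \<notin> Poly_Mapping.keys v"
      using u v by (auto simp: monomials_def)
    then show ?thesis by (simp add: in_keys_iff)
  qed
qed

theorem theorem2p3:
  fixes n :: nat
    and lt :: "nat set set mono \<Rightarrow> nat set set mono \<Rightarrow> bool"
  assumes "n \<ge> 4"
    and "revlex_order_on (cuts {1..n}) lt"
    and "\<forall>A B C D. bipartition {1..n} A B \<and> bipartition {1..n} C D \<and>
           min (card A) (card B) < min (card C) (card D) \<longrightarrow> lt (mvar {A, B}) (mvar {C, D})"
  shows
    "groebner_basis (cuts {1..n}) lt
       (cut_ideal {1..n} (complete_bipartite_edges {1, 2} {3..n}) :: (nat set set, 'k::field) mpoly set)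
       ({q A B * q ((B \<union> {1}) - {2}) ((A \<union> {2}) - {1}) - q {} {1..n} * q {1, 2} {3..n} | A B.
            bipartition {1..n} A B \<and> 1 \<in> A \<and> 2 \<in> B} \<union>
        {q A B * q C D - q (A \<inter> C) (B \<union> D) * q (A \<union> C) (B \<inter> D) | A B C D.
            bipartition {1..n} A B \<and> bipartition {1..n} C D \<and>
            1 \<in> A \<inter> C \<and> 2 \<in> B \<inter> D \<and> \<not> A \<subseteq> C \<and> \<not> C \<subseteq> A} \<union>
        {q A B * q C D - q (A \<inter> C) (B \<union> D) * q (A \<union> C) (B \<inter> D) | A B C D.
            bipartition {1..n} A B \<and> bipartition {1..n} C D \<and>
            1 \<in> A \<inter> C \<and> 2 \<in> A \<inter> C \<and> \<not> A \<subseteq> C \<and> \<not> C \<subseteq> A}) \<and>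
     (\<forall>A B. bipartition {1..n} A B \<and> 1 \<in> A \<and> 2 \<in> B \<longrightarrow>
        initial lt (q A B * q ((B \<union> {1}) - {2}) ((A \<union> {2}) - {1})
            - q {} {1..n} * q {1, 2} {3..n} :: (nat set set, 'k) mpoly)
          = q A B * q ((B \<union> {1}) - {2}) ((A \<union> {2}) - {1})) \<and>
     (\<forall>A B C D. bipartition {1..n} A B \<and> bipartition {1..n} C D \<and>
            1 \<in> A \<inter> C \<and> 2 \<in> B \<inter> D \<and> \<not> A \<subseteq> C \<and> \<not> C \<subseteq> A \<longrightarrow>
        initial lt (q A B * q C D
            - q (A \<inter> C) (B \<union> D) * q (A \<union> C) (B \<inter> D) :: (nat set set, 'k) mpoly)
          = q A B * q C D) \<and>
     (\<forall>A B C D. bipartition {1..n} A B \<and> bipartition {1..n} C D \<and>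
            1 \<in> A \<inter> C \<and> 2 \<in> A \<inter> C \<and> \<not> A \<subseteq> C \<and> \<not> C \<subseteq> A \<longrightarrow>
        initial lt (q A B * q C D
            - q (A \<inter> C) (B \<union> D) * q (A \<union> C) (B \<inter> D) :: (nat set set, 'k) mpoly)
          = q A B * q C D)"
    (is "groebner_basis ?X lt ?I (?B1 \<union> ?B2 \<union> ?B3) \<and> ?in1 \<and> ?in2 \<and> ?in3")
proof -
  have n: "n \<ge> 3" "n \<ge> 2" using assms(1) by auto
  let ?b = "\<lambda>(a, b). monomial_poly a - monomial_poly b :: (nat set set, 'k) mpoly"
  let ?P = "flip_pairs n \<union> sep_pairs n \<union> join_pairs n"
  note ord = assms(2)
  have small: "lt (mvar {A, B}) (mvar {C, D})"
    if "bipartition {1..n} A B" "bipartition {1..n} C D"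
      "min (card A) (card B) < min (card C) (card D)" for A B C D
    using assms(3) that by blast
  have flip: "binomial_pair n lt p" if "p \<in> flip_pairs n" for p
    using flip_pairs_binomial[OF n(1) ord small that] by blast
  have exch: "binomial_pair n lt (exchange A B C D)"
    if "bipartition {1..n} A B" "bipartition {1..n} C D" "1 \<in> A \<inter> C" "2 \<in> B \<inter> D \<or> 2 \<in> A \<inter> C"
      "\<not> A \<subseteq> C" "\<not> C \<subseteq> A" for A B C D
  proof -
    \<comment> \<open>Families (ii) and (iii) differ only in the side of 2; in either,
      \<open>A\<close> and \<open>C\<close> agree about it, so one lemma covers both.\<close>
    have "2 \<in> A \<longleftrightarrow> 2 \<in> C" using that(1,2,4) unfolding bipartition_def by blast
    then show ?thesis using exchange_binomial[OF ord small that(1,2,3) _ that(5,6)] by blast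
  qed
  have pairs: "binomial_pair n lt p" if "p \<in> ?P" for p
    using that flip exch unfolding sep_pairs_def join_pairs_def by blast
  let ?M = "{m \<in> monomials ?X. mono_degree m = 2}"
  have "?P \<subseteq> ?M \<times> ?M" using pairs unfolding binomial_pair_def by fastforce
  then have finP: "finite ?P"
    using finite_monomials_of_degree[OF finite_cuts[OF n(2)]] by (meson finite_SigmaI finite_subset)
  have "groebner_basis ?X lt ?I (?b ` ?P)"
  proof (rule toric_groebner_basis[where f = "cut_mono (K2_edges n)"])
    show "mono_degree u = mono_degree v" if "u \<in> monomials ?X" "v \<in> monomials ?X"
      "mono_map (cut_mono (K2_edges n)) u = mono_map (cut_mono (K2_edges n)) v" for u v
    proof -
      \<comment> \<open>Each variable maps to a monomial with exactly one factor \<open>S\<close>,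
        so the image remembers the degree.\<close>
      have deg: "mono_degree w = Poly_Mapping.lookup (mono_map (cut_mono (K2_edges n)) w) S"
        if "w \<in> monomials ?X" for w
        using that finite_cuts[OF n(2)]
        by (simp add: mono_degree_eq_sum lookup_mono_map[of ?X] lookup_cut_mono_S monomials_def)
      show ?thesis using that deg by metis
    qed
    show "?I = {p \<in> carrier (poly_ring ?X). poly_subst (\<lambda>c. monomial_poly (cut_mono (K2_edges n) c)) p = 0}"
      unfolding cut_ideal_def a_kernel_def' cut_hom_eq by (simp add: poly_ring_def)
    show "u = v" if "u \<in> monomials ?X" "v \<in> monomials ?X"
      "mono_map (cut_mono (K2_edges n)) u = mono_map (cut_mono (K2_edges n)) v"
      "\<forall>(a, b)\<in>?P. \<forall>w. u \<noteq> w + a" "\<forall>(a, b)\<in>?P. \<forall>w. v \<noteq> w + a" for u v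
      by (rule standard_monomial_eqI[OF n(1) that])
    show "a \<in> monomials ?X \<and> b \<in> monomials ?X \<and> lt b a \<and>
        mono_map (cut_mono (K2_edges n)) a = mono_map (cut_mono (K2_edges n)) b" if "(a, b) \<in> ?P" for a b
      using pairs[OF that] by (simp add: binomial_pair_def)
  qed (use finite_cuts[OF n(2)] ord finP in auto)
  moreover have "?b ` flip_pairs n = ?B1"
    unfolding flip_pairs_def q_def monomial_poly_mult by (auto simp: image_iff) blast+
  moreover have "?b ` sep_pairs n = ?B2"
    unfolding sep_pairs_def exchange_def q_def monomial_poly_mult by (auto simp: image_iff) blast+
  moreover have "?b ` join_pairs n = ?B3"
    unfolding join_pairs_def exchange_def q_def monomial_poly_mult by (auto simp: image_iff) blast+
  ultimately have "groebner_basis ?X lt ?I (?B1 \<union> ?B2 \<union> ?B3)" by (simp only: image_Un)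
  moreover have init: "initial lt (monomial_poly a - monomial_poly b :: (nat set set, 'k) mpoly) = monomial_poly a"
    if "binomial_pair n lt (a, b)" for a b
    using that by (intro initial_binomial[OF ord]) (auto simp: binomial_pair_def)
  have ?in1
    unfolding q_def monomial_poly_mult by (intro allI impI init flip) (auto simp: flip_pairs_def)
  moreover have ?in2
    unfolding q_def monomial_poly_mult by (intro allI impI init exch[unfolded exchange_def]) auto
  moreover have ?in3
    unfolding q_def monomial_poly_mult by (intro allI impI init exch[unfolded exchange_def]) auto
  ultimately show ?thesis by blast
qed

end
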